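(* Let ${\bf a}=(a_1,\ldots,a_q),{\bf b}=(b_1,\ldots,b_q)\in\mathbb N^q$, put $A=\sum a_i$, $B=\sum b_i$, and let $n\ge\max(2,A+B)$ be an integer. Then $$\Phi_n\begin{pmatrix}2{\bf a}\\ 2{\bf b}\end{pmatrix}=\sum_{r_1,\ldots,r_q}\prod_{i=1}^q\frac{4^{r_i}a_i!\,b_i!}{(2r_i)!\,(a_i-r_i)!\,(b_i-r_i)!}\;\Phi_n\big(E(2R;\,A-R,\,B-R)\big),$$ where the sum is over all $r_i\in\{0,1,\ldots,\min(a_i,b_i)\}$ and $R=\sum r_i$.
   Context: Double factorial convention (non-standard): for an integer $m\ge0$, $m!!=(m-1)(m-3)(m-5)\cdots$, the product of the positive integers $\le m-1$ of the same parity as $m-1$ (empty product $=1$); thus $0!!=1!!=2!!=1$, $3!!=2$, $4!!=3$. Ordinary factorials are written $m!$. For a $2\times q$ matrix $\begin{pmatrix}{\bf a}\\{\bf b}\end{pmatrix}$ with nonnegative integer entries and $n\ge\max(2,q)$, $I_n\begin{pmatrix}{\bf a}\\{\bf b}\end{pmatrix}=\int_{O_n}\prod_{j}u_{1j}^{a_j}u_{2j}^{b_j}\,du$ (Haar probability measure), and $$\Phi_n\begin{pmatrix}{\bf a}\\ {\bf b}\end{pmatrix}=\frac{(\Sigma a_i+n-2)!!\,(\Sigma b_i+n-2)!!}{(n-2)!!\,(n-2)!!\,\prod a_i!!\,\prod b_i!!}\,I_n\begin{pmatrix}{\bf a}\\ {\bf b}\end{pmatrix}$$ (for even entries this equals $I_n/(I_{n-1}({\bf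 a})I_{n-1}({\bf b}))$, with $I_{n-1}$ the one-row integrals over $O_{n-1}$). For integers $s,x,y\ge0$, $E(s;x,y)$ denotes the $2\times(s+x+y)$ matrix $\begin{pmatrix}1^{s}&2^{x}&0^{y}\\1^{s}&0^{x}&2^{y}\end{pmatrix}$, where $k^x$ means $x$ consecutive entries equal to $k$: its first $s$ columns are $(1,1)^T$, the next $x$ are $(2,0)^T$, the last $y$ are $(0,2)^T$. *)

theory Defs
  imports "HOL-Probability.Probability"
begin

text \<open>Non-standard double factorial: m!! = (m-1)(m-3)..., empty product 1.\<close>
fun dfact :: "nat \<Rightarrow> nat" where
  "dfact m = (if m < 2 then 1 else (m - 1) * dfact (m - 2))"

text \<open>n x n real matrices are extensional functions on {..<n} x {..<n}.\<close>
definition idx :: "nat \<Rightarrow> (nat \<times> nat) set" where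
  "idx n = {..<n} \<times> {..<n}"

definition orth :: "nat \<Rightarrow> (nat \<times> nat \<Rightarrow> real) set" where
  "orth n = {U \<in> (\<Pi>\<^sub>E p\<in>idx n. UNIV).
     \<forall>i<n. \<forall>j<n. (\<Sum>k<n. U (i,k) * U (j,k)) = (if i = j then 1 else 0)}"

definition mmul :: "nat \<Rightarrow> (nat \<times> nat \<Rightarrow> real) \<Rightarrow> (nat \<times> nat \<Rightarrow> real) \<Rightarrow> (nat \<times> nat \<Rightarrow> real)" where
  "mmul n V U = (\<lambda>(i,j)\<in>idx n. \<Sum>k<n. V (i,k) * U (k,j))"

definition haar :: "nat \<Rightarrow> (nat \<times> nat \<Rightarrow> real) measure" where
  "haar n = (THE M. sets M = sets (\<Pi>\<^sub>M p\<in>idx n. (lborel :: real measure))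
      \<and> prob_space M \<and> (AE U in M. U \<in> orth n)
      \<and> (\<forall>V\<in>orth n. distr M M (mmul n V) = M))"

text \<open>I_n of the 2 x q matrix with rows a, b (columns 0..q-1; rows of U indexed 0,1).\<close>
definition I_int :: "nat \<Rightarrow> nat \<Rightarrow> (nat \<Rightarrow> nat) \<Rightarrow> (nat \<Rightarrow> nat) \<Rightarrow> real" where
  "I_int n q a b = (\<integral>U. (\<Prod>j<q. U (0,j) ^ a j * U (1,j) ^ b j) \<partial>haar n)"

definition Phi :: "nat \<Rightarrow> nat \<Rightarrow> (nat \<Rightarrow> nat) \<Rightarrow> (nat \<Rightarrow> nat) \<Rightarrow> real" where
  "Phi n q a b =
     real (dfact ((\<Sum>j<q. a j) + n - 2) * dfact ((\<Sum>j<q. b j) + n - 2))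
     / real (dfact (n - 2) * dfact (n - 2) * (\<Prod>j<q. dfact (a j)) * (\<Prod>j<q. dfact (b j)))
     * I_int n q a b"

text \<open>E(s;x,y): 2 x (s+x+y) matrix, rows given as functions of the column index.\<close>
definition E_row1 :: "nat \<Rightarrow> nat \<Rightarrow> nat \<Rightarrow> nat" where
  "E_row1 s x j = (if j < s then 1 else if j < s + x then 2 else 0)"
definition E_row2 :: "nat \<Rightarrow> nat \<Rightarrow> nat \<Rightarrow> nat" where
  "E_row2 s x j = (if j < s then 1 else if j < s + x then 0 else 2)"

definition PhiE :: "nat \<Rightarrow> nat \<Rightarrow> nat \<Rightarrow> nat \<Rightarrow> real" where
  "PhiE n s x y = Phi n (s + x + y) (E_row1 s x) (E_row2 s x)"

end

theory Submission
  imports Defs "HOL-Combinatorics.Permutations" "HOL-Computational_Algebra.Polynomial"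
begin

text \<open>The Haar functional is invariant under rotations of the columns. Replacing a column
  \<open>(x, y)\<close> by \<open>(x, y) + t (x', y')\<close>, where column \<open>(x', y')\<close> does not occur in the monomial, multiplies
  the integral of \<open>x\<^sup>a y\<^sup>b\<close> times a monomial in the other columns by \<open>(1 + t\<^sup>2)\<^sup>m\<close> with \<open>a + b = 2m\<close>.
  The coefficient of \<open>t\<^sup>2\<close> expresses \<open>m\<close> times this integral through those in which one of the pairs
  \<open>x'\<^sup>2\<close>, \<open>x' y'\<close>, \<open>y'\<^sup>2\<close> has been split off. Since \<open>n \<ge> A + B\<close>, there are enough free
  columns to iterate until only columns \<open>(2,0)\<close>, \<open>(1,1)\<close>, \<open>(0,2)\<close> remain, and the multiplicities obey a
  recursion solved by the stated coefficients.

  Haar measure is defined by a definite description, so existence and uniqueness are needed: the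
  Gram--Schmidt map pushes Lebesgue measure on a ball of matrices to a left-invariant measure.\<close>

section \<open>Orthogonal matrices\<close>

text \<open>The combinatorics is that of pairings. For \<open>a\<close> red and \<open>b\<close>
  blue points, the weight of a column counts the perfect pairings with a given number s of mixed
  pairs, and the splitting rule marks one of the m pairs. The t^2 coefficient is the useful one
  because it releases a single pair. Recording s as the exponent of a polynomial variable makes
  weights multiplicative over columns, so the expansion is a linear functional applied to a product
  of polynomials. A fixed functional suffices because splitting preserves both row sums, and these
  together with s determine the elementary matrix up to column order and empty columns.

  The stated coefficients are pairing counts divided by the double factorials of the entries; the
  rest of the prefactor of \<open>Phi\<close> depends only on n and the row sums, hence is common to
  all terms.

  On the analytic side, the space of all matrices has infinite volume for n > 0, and Gram--Schmidt
  degenerates on dependent columns. Both are met by restricting Lebesgue measure to the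
  nondegenerate matrices in a ball, a set stable under left multiplication by orthogonal
  matrices.\<close>

definition mtrans :: "nat \<Rightarrow> (nat \<times> nat \<Rightarrow> real) \<Rightarrow> (nat \<times> nat \<Rightarrow> real)" where
  "mtrans n U = (\<lambda>(i,j)\<in>idx n. U (j,i))"

definition mid :: "nat \<Rightarrow> (nat \<times> nat \<Rightarrow> real)" where
  "mid n = (\<lambda>(i,j)\<in>idx n. if i = j then 1 else 0)"

lemma finite_idx [simp]: "finite (idx n)"
  by (simp add: idx_def)

lemma mem_idx [simp]: "(i, j) \<in> idx n \<longleftrightarrow> i < n \<and> j < n"
  by (simp add: idx_def)

lemma idx_eqI:
  assumes "X \<in> extensional (idx n)" "Y \<in> extensional (idx n)"
    and "\<And>i j. i < n \<Longrightarrow> j < n \<Longrightarrow> X (i, j) = Y (i, j)"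
  shows "X = Y"
  using assms by (intro extensionalityI[of _ "idx n"]) auto

lemma mmul_apply [simp]: "i < n \<Longrightarrow> j < n \<Longrightarrow> mmul n V U (i, j) = (\<Sum>k<n. V (i,k) * U (k,j))"
  by (simp add: mmul_def)

lemma mtrans_apply [simp]: "i < n \<Longrightarrow> j < n \<Longrightarrow> mtrans n U (i, j) = U (j, i)"
  by (simp add: mtrans_def)

lemma mid_apply [simp]: "i < n \<Longrightarrow> j < n \<Longrightarrow> mid n (i, j) = (if i = j then 1 else 0)"
  by (simp add: mid_def)

lemma mmul_extensional [simp]: "mmul n V U \<in> extensional (idx n)"
  by (simp add: mmul_def)

lemma mtrans_extensional [simp]: "mtrans n U \<in> extensional (idx n)"
  by (simp add: mtrans_def)

lemma mid_extensional [simp]: "mid n \<in> extensional (idx n)"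
  by (simp add: mid_def)

lemma mmul_assoc: "mmul n (mmul n X Y) Z = mmul n X (mmul n Y Z)"
proof (rule idx_eqI[of _ n])
  fix i j assume ij: "i < n" "j < n"
  have "mmul n (mmul n X Y) Z (i, j) = (\<Sum>k<n. \<Sum>l<n. X (i,l) * Y (l,k) * Z (k,j))"
    using ij by (simp add: sum_distrib_right)
  also have "\<dots> = (\<Sum>l<n. \<Sum>k<n. X (i,l) * Y (l,k) * Z (k,j))"
    by (rule sum.swap)
  also have "\<dots> = mmul n X (mmul n Y Z) (i, j)"
    using ij by (simp add: sum_distrib_left mult.assoc)
  finally show "mmul n (mmul n X Y) Z (i, j) = mmul n X (mmul n Y Z) (i, j)" .
qed auto

lemma mtrans_mmul: "mtrans n (mmul n X Y) = mmul n (mtrans n Y) (mtrans n X)"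
  by (rule idx_eqI[of _ n]) (auto simp: mult.commute)

lemma mtrans_mtrans: "X \<in> extensional (idx n) \<Longrightarrow> mtrans n (mtrans n X) = X"
  by (rule idx_eqI[of _ n]) auto

lemma mmul_mid_left: "X \<in> extensional (idx n) \<Longrightarrow> mmul n (mid n) X = X"
proof (rule idx_eqI[of _ n])
  fix i j assume "i < n" "j < n"
  then show "mmul n (mid n) X (i, j) = X (i, j)"
    by (simp add: if_distrib[of "\<lambda>x. x * _"] cong: if_cong)
qed auto

lemma orth_extensional: "U \<in> orth n \<Longrightarrow> U \<in> extensional (idx n)"
  by (auto simp: orth_def PiE_def)

lemma orth_iff: "U \<in> orth n \<longleftrightarrow> U \<in> extensional (idx n) \<and> mmul n U (mtrans n U) = mid n"
proof
  assume "U \<in> orth n"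
  then show "U \<in> extensional (idx n) \<and> mmul n U (mtrans n U) = mid n"
    by (auto simp: orth_def PiE_def intro!: idx_eqI[of _ n])
next
  assume *: "U \<in> extensional (idx n) \<and> mmul n U (mtrans n U) = mid n"
  have "(\<Sum>k<n. U (i,k) * U (j,k)) = (if i = j then 1 else 0)" if "i < n" "j < n" for i j
    using arg_cong[OF conjunct2[OF *], of "\<lambda>X. X (i,j)"] that by simp
  then show "U \<in> orth n"
    using * by (auto simp: orth_def PiE_def)
qed

lemma orth_mid [simp]: "mid n \<in> orth n"
proof -
  have "mtrans n (mid n) = mid n"
    by (rule idx_eqI[of _ n]) auto
  then show ?thesis
    by (simp add: orth_iff mmul_mid_left)
qed

text \<open>A one-sided inverse is two-sided: \<open>P = U\<^sup>T U\<close> is an orthogonal projection of trace \<open>n\<close>, so the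
  squared Frobenius norm of \<open>I - P\<close> is \<open>n - tr P = 0\<close>.\<close>

lemma orth_mtrans:
  assumes "U \<in> orth n"
  shows "mtrans n U \<in> orth n"
proof -
  define P where "P = mmul n (mtrans n U) U"
  have UT: "mmul n U (mtrans n U) = mid n" and ext: "U \<in> extensional (idx n)"
    using assms by (auto simp: orth_iff)
  have PP: "mmul n P P = P"
    unfolding P_def by (metis UT mmul_assoc mmul_mid_left ext)
  have sym: "P (k,l) = P (l,k)" if "k < n" "l < n" for k l
    using that by (simp add: P_def mult.commute)
  have sq: "(\<Sum>l<n. (P (k,l))\<^sup>2) = P (k,k)" if "k < n" for k
  proof -
    have "(\<Sum>l<n. (P (k,l))\<^sup>2) = (\<Sum>l<n. P (k,l) * P (l,k))"
      using that by (intro sum.cong) (auto simp: power2_eq_square sym)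
    also have "\<dots> = mmul n P P (k,k)"
      using that by simp
    finally show ?thesis by (simp add: PP)
  qed
  have "(\<Sum>k<n. P (k,k)) = (\<Sum>k<n. \<Sum>l<n. U (l,k) * U (l,k))"
    by (simp add: P_def)
  also have "\<dots> = (\<Sum>l<n. \<Sum>k<n. U (l,k) * U (l,k))"
    by (rule sum.swap)
  also have "\<dots> = real n"
    using assms by (simp add: orth_def)
  finally have tr: "(\<Sum>k<n. P (k,k)) = real n" .
  have row: "(\<Sum>l<n. ((if k = l then 1 else 0) - P (k,l))\<^sup>2) = 1 - P (k,k)" if "k < n" for k
  proof -
    have "(\<Sum>l<n. ((if k = l then 1 else 0) - P (k,l))\<^sup>2)
        = (\<Sum>l<n. (if k = l then 1 - 2 * P (k,l) else 0) + (P (k,l))\<^sup>2)"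
      by (intro sum.cong) (auto simp: power2_eq_square algebra_simps)
    also have "\<dots> = 1 - P (k,k)"
      using that by (simp add: sum.distrib sq)
    finally show ?thesis .
  qed
  have "(\<Sum>k<n. \<Sum>l<n. ((if k = l then 1 else 0) - P (k,l))\<^sup>2) = 0"
    using tr by (simp add: row sum_subtractf)
  then have z: "(\<Sum>l<n. ((if k = l then 1 else 0) - P (k,l))\<^sup>2) = 0" if "k < n" for k
    using that by (subst (asm) sum_nonneg_eq_0_iff) (auto intro: sum_nonneg)
  have "P (k,l) = (if k = l then 1 else 0)" if "k < n" "l < n" for k l
  proof -
    have "((if k = l then 1 else 0) - P (k,l))\<^sup>2 = 0"
      using z[OF that(1)] that by (subst (asm) sum_nonneg_eq_0_iff) auto
    then show ?thesis by simp
  qed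
  then have "P = mid n"
    by (intro idx_eqI[of _ n]) (auto simp: P_def)
  then show ?thesis
    by (simp add: orth_iff P_def mtrans_mtrans[OF ext])
qed

lemma orth_mtrans_mmul: "U \<in> orth n \<Longrightarrow> mmul n (mtrans n U) U = mid n"
  using orth_mtrans[of U n] by (auto simp: orth_iff mtrans_mtrans)

lemma orth_mmul_mtrans: "U \<in> orth n \<Longrightarrow> mmul n U (mtrans n U) = mid n"
  by (simp add: orth_iff)

text \<open>The membership condition of \<open>orth\<close> concerns rows, whereas acting on column
  vectors requires V^T V to be the identity; this comes from \<open>orth_mtrans_mmul\<close>. Both
  the norm and Gram--Schmidt are built from such inner products.\<close>

lemma orth_column_inner:
  assumes "V \<in> orth n"
  shows "(\<Sum>i<n. (\<Sum>k<n. V (i,k) * x k) * (\<Sum>l<n. V (i,l) * y l)) = (\<Sum>k<n. x k * y k)"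
proof -
  have V: "(\<Sum>i<n. V (i,k) * V (i,l)) = (if k = l then 1 else 0)" if "k < n" "l < n" for k l
    using arg_cong[OF orth_mtrans_mmul[OF assms], of "\<lambda>X. X (k,l)"] that by simp
  have "(\<Sum>i<n. (\<Sum>k<n. V (i,k) * x k) * (\<Sum>l<n. V (i,l) * y l))
      = (\<Sum>i<n. \<Sum>k<n. \<Sum>l<n. x k * y l * (V (i,k) * V (i,l)))"
    by (simp add: sum_product mult_ac)
  also have "\<dots> = (\<Sum>k<n. \<Sum>i<n. \<Sum>l<n. x k * y l * (V (i,k) * V (i,l)))"
    by (rule sum.swap)
  also have "\<dots> = (\<Sum>k<n. \<Sum>l<n. \<Sum>i<n. x k * y l * (V (i,k) * V (i,l)))"
    by (intro sum.cong refl sum.swap)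
  also have "\<dots> = (\<Sum>k<n. \<Sum>l<n. if k = l then x k * y l else 0)"
    by (intro sum.cong refl) (simp add: V flip: sum_distrib_left)
  also have "\<dots> = (\<Sum>k<n. x k * y k)"
    by simp
  finally show ?thesis .
qed

section \<open>Lebesgue measure on matrices\<close>

abbreviation leb :: "nat \<Rightarrow> (nat \<times> nat \<Rightarrow> real) measure" where
  "leb n \<equiv> \<Pi>\<^sub>M p\<in>idx n. lborel"

definition madd :: "nat \<Rightarrow> (nat \<times> nat \<Rightarrow> real) \<Rightarrow> (nat \<times> nat \<Rightarrow> real) \<Rightarrow> (nat \<times> nat \<Rightarrow> real)" where
  "madd n X Y = (\<lambda>p\<in>idx n. X p + Y p)"

definition mneg :: "nat \<Rightarrow> (nat \<times> nat \<Rightarrow> real) \<Rightarrow> (nat \<times> nat \<Rightarrow> real)" where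
  "mneg n X = (\<lambda>p\<in>idx n. - X p)"

definition normsq :: "nat \<Rightarrow> (nat \<times> nat \<Rightarrow> real) \<Rightarrow> real" where
  "normsq n X = (\<Sum>j<n. \<Sum>i<n. (X (i,j))\<^sup>2)"

lemma space_leb: "space (leb n) = extensional (idx n)"
  by (simp add: space_PiM PiE_def)

text \<open>No range condition on i and j, so that measurability proofs produce no side conditions:
  outside \<open>idx n\<close> extensional functions have the constant value
  \<open>undefined\<close>.\<close>

lemma measurable_entry [measurable]: "(\<lambda>X. X (i,j)) \<in> borel_measurable (leb n)"
proof (cases "(i,j) \<in> idx n")
  case True
  have "(\<lambda>X. X (i,j)) \<in> measurable (leb n) lborel"
    by (rule measurable_component_singleton[OF True])
  then show ?thesis by simp
next
  case False
  then have "X (i,j) = undefined" if "X \<in> space (leb n)" for X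
    using that by (auto simp: space_leb extensional_def)
  then show ?thesis
    by (subst measurable_cong[where g="\<lambda>_. undefined"]) auto
qed

lemma measurable_lebI:
  assumes "\<And>x. x \<in> space M \<Longrightarrow> f x \<in> extensional (idx n)"
    and "\<And>i j. i < n \<Longrightarrow> j < n \<Longrightarrow> (\<lambda>x. f x (i,j)) \<in> borel_measurable M"
  shows "f \<in> measurable M (leb n)"
  using assms by (intro measurable_PiM_single') (auto simp: PiE_def)

lemma measurable_mmul [measurable (raw)]:
  assumes [measurable]: "f \<in> measurable M (leb n)" "g \<in> measurable M (leb n)"
  shows "(\<lambda>x. mmul n (f x) (g x)) \<in> measurable M (leb n)"
  by (rule measurable_lebI) auto

lemma measurable_mtrans [measurable (raw)]:
  assumes [measurable]: "f \<in> measurable M (leb n)"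
  shows "(\<lambda>x. mtrans n (f x)) \<in> measurable M (leb n)"
  by (rule measurable_lebI) auto

lemma measurable_madd [measurable (raw)]:
  assumes [measurable]: "f \<in> measurable M (leb n)" "g \<in> measurable M (leb n)"
  shows "(\<lambda>x. madd n (f x) (g x)) \<in> measurable M (leb n)"
  by (rule measurable_lebI) (auto simp: madd_def)

lemma measurable_mneg [measurable (raw)]:
  assumes [measurable]: "f \<in> measurable M (leb n)"
  shows "(\<lambda>x. mneg n (f x)) \<in> measurable M (leb n)"
  by (rule measurable_lebI) (auto simp: mneg_def)

lemma measurable_normsq [measurable]: "normsq n \<in> borel_measurable (leb n)"
  unfolding normsq_def by measurable

lemma orth_sets [measurable]: "orth n \<in> sets (leb n)"
proof -
  have "orth n = {U \<in> space (leb n). \<forall>i\<in>{..<n}. \<forall>j\<in>{..<n}. (\<Sum>k<n. U (i,k) * U (j,k)) = (if i = j then 1 else 0)}"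
    by (auto simp: orth_def space_PiM)
  also have "\<dots> \<in> sets (leb n)"
    by measurable
  finally show ?thesis .
qed

section \<open>Invariance of Lebesgue measure under translations and orthogonal matrices\<close>

interpretation leb: product_sigma_finite "\<lambda>_. lborel :: real measure"
  by standard

lemma sigma_finite_leb: "sigma_finite_measure (leb n)"
  by (intro leb.sigma_finite) simp

text \<open>A product measure is determined by its values on boxes, and a translation pulls a box
  back to a box, so the one-dimensional case suffices in each coordinate.\<close>

lemma distr_leb_madd:
  assumes "Y \<in> space (leb n)"
  shows "distr (leb n) (leb n) (\<lambda>X. madd n X Y) = leb n"
proof (rule leb.PiM_eqI)
  have [measurable]: "(\<lambda>X. madd n X Y) \<in> measurable (leb n) (leb n)"
    using assms by measurable
  fix A :: "nat \<times> nat \<Rightarrow> real set" assume A: "\<And>i. i \<in> idx n \<Longrightarrow> A i \<in> sets lborel"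
  have A': "(\<lambda>x. x + Y p) -` A p \<in> sets lborel" if "p \<in> idx n" for p
    using measurable_sets[of "\<lambda>x. x + Y p" lborel lborel "A p"] A[OF that] by simp
  have "emeasure (distr (leb n) (leb n) (\<lambda>X. madd n X Y)) (Pi\<^sub>E (idx n) A)
     = emeasure (leb n) ((\<lambda>X. madd n X Y) -` Pi\<^sub>E (idx n) A \<inter> space (leb n))"
    using A by (intro emeasure_distr) auto
  also have "(\<lambda>X. madd n X Y) -` Pi\<^sub>E (idx n) A \<inter> space (leb n) = Pi\<^sub>E (idx n) (\<lambda>p. (\<lambda>x. x + Y p) -` A p)"
    unfolding set_eq_iff Int_iff vimage_eq space_leb PiE_iff madd_def
    by (metis (no_types, lifting) restrict_apply restrict_extensional)
  also have "emeasure (leb n) \<dots> = (\<Prod>p\<in>idx n. emeasure lborel ((\<lambda>x. x + Y p) -` A p))"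
    using A' by (intro leb.emeasure_PiM) auto
  also have "\<dots> = (\<Prod>p\<in>idx n. emeasure lborel (A p))"
  proof (rule prod.cong)
    fix p assume p: "p \<in> idx n"
    have "emeasure lborel (A p) = emeasure (distr lborel borel ((+) (Y p))) (A p)"
      by (simp add: lborel_distr_plus)
    also have "\<dots> = emeasure lborel ((\<lambda>x. x + Y p) -` A p)"
      using A[OF p] by (subst emeasure_distr) (auto simp: add.commute vimage_def)
    finally show "emeasure lborel ((\<lambda>x. x + Y p) -` A p) = emeasure lborel (A p)" by simp
  qed simp
  finally show "emeasure (distr (leb n) (leb n) (\<lambda>X. madd n X Y)) (Pi\<^sub>E (idx n) A) = (\<Prod>p\<in>idx n. emeasure lborel (A p))" .
qed auto

lemma nn_integral_leb_madd:
  assumes "Y \<in> space (leb n)" and [measurable]: "f \<in> borel_measurable (leb n)"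
  shows "(\<integral>\<^sup>+X. f (madd n X Y) \<partial>leb n) = (\<integral>\<^sup>+X. f X \<partial>leb n)"
proof -
  have "(\<integral>\<^sup>+X. f X \<partial>leb n) = (\<integral>\<^sup>+X. f X \<partial>distr (leb n) (leb n) (\<lambda>X. madd n X Y))"
    by (simp add: distr_leb_madd assms(1))
  also have "\<dots> = (\<integral>\<^sup>+X. f (madd n X Y) \<partial>leb n)"
    using assms(1) by (intro nn_integral_distr) measurable
  finally show ?thesis ..
qed

lemma normsq_mmul:
  assumes "V \<in> orth n"
  shows "normsq n (mmul n V X) = normsq n X"
proof -
  have "(\<Sum>i<n. (mmul n V X (i,j))\<^sup>2) = (\<Sum>i<n. (X (i,j))\<^sup>2)" if "j < n" for j
    using that by (simp add: power2_eq_square orth_column_inner[OF assms])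
  then show ?thesis
    by (simp add: normsq_def del: mmul_apply)
qed

lemma normsq_leb_finite: "emeasure (leb n) {X \<in> space (leb n). normsq n X \<le> c} < \<infinity>"
proof -
  \<comment> \<open>Since d \<ge> 1, d is at most its square; a squared entry bounded by c then
    gives an entry bounded by d, without a square root of c.\<close>
  define d where "d = 1 + \<bar>c\<bar>"
  have "{X \<in> space (leb n). normsq n X \<le> c} \<subseteq> Pi\<^sub>E (idx n) (\<lambda>_. {-d..d})"
  proof (clarsimp simp: space_leb PiE_iff)
    fix X i j assume *: "normsq n X \<le> c" "i < n" "j < n"
    have "(X (i,j))\<^sup>2 \<le> (\<Sum>i<n. (X (i,j))\<^sup>2)"
      using * by (intro member_le_sum) auto
    also have "\<dots> \<le> normsq n X"
      unfolding normsq_def using * by (intro member_le_sum) (auto intro: sum_nonneg)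
    finally have "(X (i,j))\<^sup>2 \<le> d"
      using * by (simp add: d_def)
    also have "d \<le> d\<^sup>2"
      by (simp add: d_def power2_eq_square algebra_simps)
    finally have "\<bar>X (i,j)\<bar> \<le> d"
      by (metis abs_ge_zero abs_le_square_iff abs_of_nonneg d_def add_nonneg_nonneg zero_le_one)
    then show "- d \<le> X (i,j) \<and> X (i,j) \<le> d" by auto
  qed
  then have "emeasure (leb n) {X \<in> space (leb n). normsq n X \<le> c} \<le> emeasure (leb n) (Pi\<^sub>E (idx n) (\<lambda>_. {-d..d}))"
    by (intro emeasure_mono) auto
  also have "\<dots> = (\<Prod>p\<in>idx n. emeasure lborel {-d..d})"
    by (intro leb.emeasure_PiM) auto
  also have "\<dots> < \<infinity>"
    by (simp add: d_def ennreal_power power_less_top_ennreal)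
  finally show ?thesis .
qed

text \<open>The pushforward under \<open>V\<close> is translation invariant; playing it off against Lebesgue measure
  with Fubini shows that the two are proportional, and the ball fixes the constant.\<close>

lemma nn_integral_leb_mmul_mneg:
  assumes V: "V \<in> orth n" and [measurable]: "f \<in> borel_measurable (leb n)"
    and pos: "0 < emeasure (leb n) {X \<in> space (leb n). normsq n X \<le> c}"
  shows "(\<integral>\<^sup>+X. f (mmul n V X) \<partial>leb n) = (\<integral>\<^sup>+X. f (mneg n X) \<partial>leb n)"
proof -
  interpret pair_sigma_finite "leb n" "leb n"
    by (simp add: pair_sigma_finite_def sigma_finite_leb)
  let ?B = "{X \<in> space (leb n). normsq n X \<le> c}"
  \<comment> \<open>The test function: invariant under V, with positive finite integral, so that it
    can be cancelled at the end.\<close>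
  define g :: "(nat \<times> nat \<Rightarrow> real) \<Rightarrow> ennreal" where "g = indicator ?B"
  have [measurable]: "g \<in> borel_measurable (leb n)"
    unfolding g_def by measurable
  have Vs [simp]: "V \<in> space (leb n)" "mtrans n V \<in> space (leb n)"
    using orth_extensional[OF V] by (auto simp: space_leb)
  have Vs' [simp]: "mmul n V X \<in> space (leb n)" "mneg n X \<in> space (leb n)" for X
    by (auto simp: space_leb mneg_def)
  have gV: "g (mmul n V X) = g X" if "X \<in> space (leb n)" for X
    using that by (simp add: g_def indicator_def normsq_mmul[OF V])
  have [measurable]: "(\<lambda>X. mmul n V X) \<in> measurable (leb n) (leb n)"
    by (intro measurable_mmul) auto
  let ?g = "\<integral>\<^sup>+Y. g Y \<partial>leb n"
  have "(\<integral>\<^sup>+X. f (mmul n V X) \<partial>leb n) * ?g = (\<integral>\<^sup>+X. f (mmul n V X) * ?g \<partial>leb n)"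
    by (subst nn_integral_multc) auto
  \<comment> \<open>Translation invariance in Y inserts the shift by VX, which couples the two
    variables.\<close>
  also have "\<dots> = (\<integral>\<^sup>+X. f (mmul n V X) * (\<integral>\<^sup>+Y. g (madd n Y (mmul n V X)) \<partial>leb n) \<partial>leb n)"
    by (intro nn_integral_cong) (simp add: nn_integral_leb_madd)
  also have "\<dots> = (\<integral>\<^sup>+X. (\<integral>\<^sup>+Y. f (mmul n V X) * g (madd n Y (mmul n V X)) \<partial>leb n) \<partial>leb n)"
    by (intro nn_integral_cong nn_integral_cmult[symmetric]) measurable
  also have "\<dots> = (\<integral>\<^sup>+Y. (\<integral>\<^sup>+X. f (mmul n V X) * g (madd n Y (mmul n V X)) \<partial>leb n) \<partial>leb n)"
    by (intro Fubini') measurable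
  also have "\<dots> = (\<integral>\<^sup>+Y. (\<integral>\<^sup>+X. f (madd n (mneg n Y) (mmul n V X)) * g (mmul n V X) \<partial>leb n) \<partial>leb n)"
  proof (rule nn_integral_cong)
    fix Y assume Y [measurable, simp]: "Y \<in> space (leb n)"
    \<comment> \<open>Shifting X by - V^T Y turns VX into VX - Y, which moves Y from the argument of
      \<open>g\<close> to that of \<open>f\<close>. The sign of Y here is the origin of
      \<open>mneg\<close>.\<close>
    define Z where "Z = mmul n (mtrans n V) (mneg n Y)"
    have Z: "Z \<in> space (leb n)"
      by (simp add: Z_def space_leb)
    have VZ: "mmul n V (madd n X Z) = madd n (mneg n Y) (mmul n V X)" for X
    proof -
      have "mmul n V Z = mneg n Y"
        unfolding Z_def by (simp flip: mmul_assoc add: orth_mmul_mtrans[OF V] mmul_mid_left mneg_def)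
      then have "(\<Sum>k<n. V (i,k) * Z (k,j)) = - Y (i,j)" if "i < n" "j < n" for i j
        using that arg_cong[of "mmul n V Z" "mneg n Y" "\<lambda>X. X (i,j)"]
        by (simp add: mneg_def del: mmul_apply flip: mmul_apply)
      then show ?thesis
        by (intro idx_eqI[of _ n]) (auto simp: madd_def mneg_def distrib_left sum.distrib)
    qed
    have [measurable]: "(\<lambda>X. f (mmul n V X) * g (madd n Y (mmul n V X))) \<in> borel_measurable (leb n)"
      by measurable
    have "(\<integral>\<^sup>+X. f (mmul n V X) * g (madd n Y (mmul n V X)) \<partial>leb n)
      = (\<integral>\<^sup>+X. f (mmul n V (madd n X Z)) * g (madd n Y (mmul n V (madd n X Z))) \<partial>leb n)"
      by (subst nn_integral_leb_madd[OF Z, of "\<lambda>X. f (mmul n V X) * g (madd n Y (mmul n V X))"]) auto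
    also have "\<dots> = (\<integral>\<^sup>+X. f (madd n (mneg n Y) (mmul n V X)) * g (mmul n V X) \<partial>leb n)"
    proof -
      have "madd n Y (madd n (mneg n Y) (mmul n V X)) = mmul n V X" for X
        by (rule idx_eqI[of _ n]) (auto simp: madd_def mneg_def)
      then show ?thesis by (simp add: VZ)
    qed
    finally show "(\<integral>\<^sup>+X. f (mmul n V X) * g (madd n Y (mmul n V X)) \<partial>leb n)
      = (\<integral>\<^sup>+X. f (madd n (mneg n Y) (mmul n V X)) * g (mmul n V X) \<partial>leb n)" .
  qed
  also have "\<dots> = (\<integral>\<^sup>+X. (\<integral>\<^sup>+Y. f (madd n (mneg n Y) (mmul n V X)) * g (mmul n V X) \<partial>leb n) \<partial>leb n)"
    by (intro Fubini') measurable
  also have "\<dots> = (\<integral>\<^sup>+X. (\<integral>\<^sup>+Y. f (madd n (mneg n Y) (mmul n V X)) \<partial>leb n) * g X \<partial>leb n)"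
    by (intro nn_integral_cong) (simp add: gV nn_integral_multc)
  also have "\<dots> = (\<integral>\<^sup>+X. (\<integral>\<^sup>+Y. f (mneg n Y) \<partial>leb n) * g X \<partial>leb n)"
  proof -
    have "(\<integral>\<^sup>+Y. f (madd n (mneg n Y) (mmul n V X)) \<partial>leb n) = (\<integral>\<^sup>+Y. f (mneg n Y) \<partial>leb n)" for X
    proof -
      have "(\<integral>\<^sup>+Y. f (mneg n Y) \<partial>leb n) = (\<integral>\<^sup>+Y. f (mneg n (madd n Y (mneg n (mmul n V X)))) \<partial>leb n)"
        by (subst nn_integral_leb_madd[where f="\<lambda>Y. f (mneg n Y)"]) auto
      also have "\<dots> = (\<integral>\<^sup>+Y. f (madd n (mneg n Y) (mmul n V X)) \<partial>leb n)"
        by (intro nn_integral_cong arg_cong[of _ _ f] idx_eqI[of _ n]) (auto simp: madd_def mneg_def)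
      finally show ?thesis ..
    qed
    then show ?thesis by simp
  qed
  also have "\<dots> = (\<integral>\<^sup>+Y. f (mneg n Y) \<partial>leb n) * ?g"
    by (simp add: nn_integral_cmult)
  finally have eq: "(\<integral>\<^sup>+X. f (mmul n V X) \<partial>leb n) * ?g = (\<integral>\<^sup>+Y. f (mneg n Y) \<partial>leb n) * ?g" .
  have "?g = emeasure (leb n) ?B"
    unfolding g_def by simp
  then have "?g \<noteq> 0" "?g \<noteq> \<infinity>"
    using pos normsq_leb_finite[of n c] by auto
  then show ?thesis
    using eq by (metis infinity_ennreal_def mult_divide_eq_ennreal)
qed

text \<open>The integral of \<open>f (mneg n X)\<close> in the preceding lemma is the same for every
  V; comparing V with the identity matrix eliminates the reflection.\<close>

lemma distr_leb_mmul:
  assumes V: "V \<in> orth n"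
    and pos: "0 < emeasure (leb n) {X \<in> space (leb n). normsq n X \<le> c}"
  shows "distr (leb n) (leb n) (mmul n V) = leb n"
proof (rule measure_eqI)
  have Vs [simp]: "V \<in> space (leb n)"
    using orth_extensional[OF V] by (auto simp: space_leb)
  have [measurable]: "(\<lambda>X. mmul n V X) \<in> measurable (leb n) (leb n)"
    by (intro measurable_mmul) auto
  fix E assume "E \<in> sets (distr (leb n) (leb n) (mmul n V))"
  then have [measurable]: "E \<in> sets (leb n)" by simp
  have "emeasure (distr (leb n) (leb n) (mmul n V)) E
      = (\<integral>\<^sup>+X. indicator E (mmul n V X) \<partial>leb n)"
    by (subst nn_integral_distr[of "mmul n V" "leb n" "leb n" "indicator E", symmetric]) auto
  also have "\<dots> = (\<integral>\<^sup>+X. indicator E (mneg n X) \<partial>leb n)"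
    by (rule nn_integral_leb_mmul_mneg[OF V _ pos]) auto
  also have "\<dots> = (\<integral>\<^sup>+X. indicator E (mmul n (mid n) X) \<partial>leb n)"
    by (rule nn_integral_leb_mmul_mneg[OF orth_mid _ pos, symmetric]) auto
  also have "\<dots> = (\<integral>\<^sup>+X. indicator E X \<partial>leb n)"
    by (intro nn_integral_cong) (simp add: mmul_mid_left space_leb)
  finally show "emeasure (distr (leb n) (leb n) (mmul n V)) E = emeasure (leb n) E"
    by simp
qed simp

section \<open>Gram--Schmidt orthonormalisation of the columns\<close>

text \<open>\<open>gs n X k\<close> is the k-th orthonormalised column as a function of the row. The
  guard \<open>l < k\<close> displays the decrease of the recursive calls to the termination proof;
  \<open>gs_eq\<close> removes it. A zero residual yields a zero column, because division by 0 gives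
  0.\<close>

fun gs :: "nat \<Rightarrow> (nat \<times> nat \<Rightarrow> real) \<Rightarrow> nat \<Rightarrow> nat \<Rightarrow> real" where
  "gs n X k = (let r = (\<lambda>i. X (i,k) - (\<Sum>l<k. if l < k then (\<Sum>m<n. X (m,k) * gs n X l m) * gs n X l i else 0))
     in (\<lambda>i. r i / sqrt (\<Sum>m<n. (r m)\<^sup>2)))"

declare gs.simps [simp del]

definition gs_res :: "nat \<Rightarrow> (nat \<times> nat \<Rightarrow> real) \<Rightarrow> nat \<Rightarrow> nat \<Rightarrow> real" where
  "gs_res n X k i = X (i,k) - (\<Sum>l<k. (\<Sum>m<n. X (m,k) * gs n X l m) * gs n X l i)"

definition gs_mat :: "nat \<Rightarrow> (nat \<times> nat \<Rightarrow> real) \<Rightarrow> (nat \<times> nat \<Rightarrow> real)" where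
  "gs_mat n X = (\<lambda>(i,k)\<in>idx n. gs n X k i)"

definition gs_regular :: "nat \<Rightarrow> (nat \<times> nat \<Rightarrow> real) \<Rightarrow> bool" where
  "gs_regular n X \<longleftrightarrow> (\<forall>k\<in>{..<n}. (\<Sum>m<n. (gs_res n X k m)\<^sup>2) \<noteq> 0)"

lemma gs_eq: "gs n X k i = gs_res n X k i / sqrt (\<Sum>m<n. (gs_res n X k m)\<^sup>2)"
proof -
  have "(\<Sum>l<k. if l < k then (\<Sum>m<n. X (m,k) * gs n X l m) * gs n X l i else 0)
      = (\<Sum>l<k. (\<Sum>m<n. X (m,k) * gs n X l m) * gs n X l i)" for i
    by (intro sum.cong) auto
  then show ?thesis
    by (subst gs.simps) (simp add: Let_def gs_res_def)
qed

lemma gs_mat_apply [simp]: "i < n \<Longrightarrow> k < n \<Longrightarrow> gs_mat n X (i,k) = gs n X k i"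
  by (simp add: gs_mat_def)

lemma gs_mat_extensional [simp]: "gs_mat n X \<in> extensional (idx n)"
  by (simp add: gs_mat_def)

text \<open>Gram--Schmidt uses only linear combinations and inner products of columns, and left
  multiplication by V respects both. The residual and its norm at k rest on the normalised columns
  before k, so all three claims share an induction.\<close>

lemma gs_mmul:
  assumes V: "V \<in> orth n" and k: "k < n"
  shows "(\<forall>i<n. gs_res n (mmul n V X) k i = (\<Sum>j<n. V (i,j) * gs_res n X k j)) \<and>
    (\<Sum>m<n. (gs_res n (mmul n V X) k m)\<^sup>2) = (\<Sum>m<n. (gs_res n X k m)\<^sup>2) \<and>
    (\<forall>i<n. gs n (mmul n V X) k i = (\<Sum>j<n. V (i,j) * gs n X k j))"
  using k
proof (induction k rule: less_induct)
  case (less k)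
  have IH: "gs n (mmul n V X) l i = (\<Sum>j<n. V (i,j) * gs n X l j)" if "l < k" "i < n" for l i
    using less that by auto
  have inner: "(\<Sum>m<n. mmul n V X (m,k) * gs n (mmul n V X) l m) = (\<Sum>m<n. X (m,k) * gs n X l m)"
    if "l < k" for l
    using that less.prems by (simp add: IH orth_column_inner[OF V])
  have res: "gs_res n (mmul n V X) k i = (\<Sum>j<n. V (i,j) * gs_res n X k j)" if "i < n" for i
  proof -
    have "gs_res n (mmul n V X) k i
      = (\<Sum>j<n. V (i,j) * X (j,k)) - (\<Sum>l<k. (\<Sum>m<n. X (m,k) * gs n X l m) * (\<Sum>j<n. V (i,j) * gs n X l j))"
      unfolding gs_res_def using that less.prems inner IH
      by (intro arg_cong2[where f="(-)"] sum.cong) auto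
    also have "(\<Sum>l<k. (\<Sum>m<n. X (m,k) * gs n X l m) * (\<Sum>j<n. V (i,j) * gs n X l j))
      = (\<Sum>j<n. V (i,j) * (\<Sum>l<k. (\<Sum>m<n. X (m,k) * gs n X l m) * gs n X l j))"
      by (subst sum_distrib_left, subst sum_distrib_left, subst sum.swap) (simp add: mult_ac)
    finally show ?thesis
      by (simp add: gs_res_def right_diff_distrib sum_subtractf)
  qed
  moreover have norm: "(\<Sum>m<n. (gs_res n (mmul n V X) k m)\<^sup>2) = (\<Sum>m<n. (gs_res n X k m)\<^sup>2)"
    by (simp add: res power2_eq_square orth_column_inner[OF V])
  moreover have "gs n (mmul n V X) k i = (\<Sum>j<n. V (i,j) * gs n X k j)" if "i < n" for i
    unfolding gs_eq norm res[OF that] by (simp add: sum_divide_distrib)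
  ultimately show ?case by blast
qed

lemma gs_mat_mmul: "V \<in> orth n \<Longrightarrow> gs_mat n (mmul n V X) = mmul n V (gs_mat n X)"
  by (rule idx_eqI[of _ n]) (auto simp: gs_mmul)

lemma gs_regular_mmul: "V \<in> orth n \<Longrightarrow> gs_regular n (mmul n V X) \<longleftrightarrow> gs_regular n X"
  by (auto simp: gs_regular_def gs_mmul[THEN conjunct2, THEN conjunct1])

lemma gs_orthonormal:
  assumes reg: "gs_regular n X" and k: "k < n"
  shows "\<forall>l\<le>k. (\<Sum>m<n. gs n X l m * gs n X k m) = (if l = k then 1 else 0)"
  using k
proof (induction k rule: less_induct)
  case (less k)
  let ?N = "\<Sum>m<n. (gs_res n X k m)\<^sup>2"
  have N: "?N > 0"
    using reg less.prems sum_nonneg[of "{..<n}" "\<lambda>m. (gs_res n X k m)\<^sup>2"]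
    by (auto simp: gs_regular_def order_less_le)
  have IH: "(\<Sum>m<n. gs n X l m * gs n X l' m) = (if l = l' then 1 else 0)" if "l < k" "l' < k" for l l'
  proof (cases "l \<le> l'")
    case True
    then show ?thesis using less that by auto
  next
    case False
    then have "(\<Sum>m<n. gs n X l' m * gs n X l m) = (if l' = l then 1 else 0)"
      using less that by auto
    then show ?thesis by (simp add: mult.commute)
  qed
  have "(\<Sum>m<n. gs n X l m * gs n X k m) = 0" if "l < k" for l
  proof -
    let ?c = "\<lambda>l. \<Sum>m<n. X (m,k) * gs n X l m"
    have "(\<Sum>m<n. gs n X l m * gs_res n X k m)
        = ?c l - (\<Sum>m<n. \<Sum>l'<k. ?c l' * (gs n X l m * gs n X l' m))"
      by (simp add: gs_res_def right_diff_distrib sum_subtractf sum_distrib_left mult_ac)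
    also have "(\<Sum>m<n. \<Sum>l'<k. ?c l' * (gs n X l m * gs n X l' m))
        = (\<Sum>l'<k. ?c l' * (\<Sum>m<n. gs n X l m * gs n X l' m))"
      by (subst sum.swap) (simp add: sum_distrib_left)
    also have "\<dots> = (\<Sum>l'<k. if l = l' then ?c l' else 0)"
      using that by (intro sum.cong) (auto simp: IH)
    also have "\<dots> = ?c l"
      using that by simp
    finally have "(\<Sum>m<n. gs n X l m * gs_res n X k m) = 0" by simp
    then show ?thesis
      by (simp add: gs_eq[of n X k] flip: sum_divide_distrib)
  qed
  moreover have "(\<Sum>m<n. gs n X k m * gs n X k m) = 1"
  proof -
    have "(\<Sum>m<n. gs n X k m * gs n X k m) = (\<Sum>m<n. (gs_res n X k m)\<^sup>2 / ?N)"
      using N by (intro sum.cong) (auto simp: gs_eq power_divide power2_eq_square[symmetric])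
    also have "\<dots> = 1"
      using N by (simp flip: sum_divide_distrib)
    finally show ?thesis .
  qed
  ultimately show ?case
    by (auto simp: order_le_less)
qed

lemma gs_mat_orth:
  assumes "gs_regular n X"
  shows "gs_mat n X \<in> orth n"
proof -
  have *: "(\<Sum>m<n. gs n X l m * gs n X k m) = (if l = k then 1 else 0)" if "l < n" "k < n" for l k
  proof (cases "l \<le> k")
    case True
    then show ?thesis using gs_orthonormal[OF assms that(2)] by auto
  next
    case False
    then have "(\<Sum>m<n. gs n X k m * gs n X l m) = (if k = l then 1 else 0)"
      using gs_orthonormal[OF assms that(1)] by auto
    then show ?thesis by (simp add: mult.commute)
  qed
  \<comment> \<open>Orthonormal columns are orthonormal rows of the transpose, the form that
    \<open>orth\<close> asks for.\<close>
  have "mtrans n (gs_mat n X) \<in> orth n"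
    by (auto simp: orth_def PiE_def *)
  from orth_mtrans[OF this] show ?thesis
    by (simp add: mtrans_mtrans)
qed

lemma measurable_gs [measurable]: "(\<lambda>X. gs n X k i) \<in> borel_measurable (leb n)"
proof (induction k arbitrary: i rule: less_induct)
  case (less k)
  have [measurable]: "(\<lambda>X. gs_res n X k i) \<in> borel_measurable (leb n)" for i
    unfolding gs_res_def using less
    by (intro borel_measurable_diff borel_measurable_sum borel_measurable_times measurable_entry) auto
  show ?case
    unfolding gs_eq[of n _ k] by measurable
qed

lemma measurable_gs_res [measurable]: "(\<lambda>X. gs_res n X k i) \<in> borel_measurable (leb n)"
  unfolding gs_res_def by measurable

lemma measurable_gs_mat [measurable]: "gs_mat n \<in> measurable (leb n) (leb n)"
  by (rule measurable_lebI) auto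

lemma measurable_gs_regular [measurable]: "Measurable.pred (leb n) (gs_regular n)"
  unfolding gs_regular_def by measurable

text \<open>The coefficient 1 at column k is the point: a vanishing residual then becomes a
  nontrivial linear relation between the columns.\<close>

lemma gs_res_combination: "\<exists>c. c k = 1 \<and> (\<forall>i. gs_res n X k i = (\<Sum>l\<le>k. c l * X (i,l)))"
proof (induction k rule: less_induct)
  case (less k)
  have "\<exists>d. \<forall>i. gs n X l i = (\<Sum>m\<le>l. d m * X (i,m))" if l: "l < k" for l
  proof -
    obtain c where "\<And>i. gs_res n X l i = (\<Sum>m\<le>l. c m * X (i,m))"
      using less[OF l] by blast
    then show ?thesis
      by (intro exI[of _ "\<lambda>m. c m / sqrt (\<Sum>m<n. (gs_res n X l m)\<^sup>2)"])
        (simp add: gs_eq[of n X l] sum_divide_distrib)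
  qed
  then obtain d where d: "\<And>l i. l < k \<Longrightarrow> gs n X l i = (\<Sum>m\<le>l. d l m * X (i,m))"
    by metis
  let ?p = "\<lambda>l. \<Sum>m<n. X (m,k) * gs n X l m"
  define c where "c m = (if m = k then 1 else - (\<Sum>l<k. if m \<le> l then ?p l * d l m else 0))" for m
  have "gs_res n X k i = (\<Sum>m\<le>k. c m * X (i,m))" for i
  proof -
    have "(\<Sum>l<k. ?p l * gs n X l i) = (\<Sum>l<k. \<Sum>m<k. if m \<le> l then ?p l * d l m * X (i,m) else 0)"
    proof (intro sum.cong refl)
      fix l assume "l \<in> {..<k}"
      then have "{m \<in> {..<k}. m \<le> l} = {..l}" by auto
      then show "?p l * gs n X l i = (\<Sum>m<k. if m \<le> l then ?p l * d l m * X (i,m) else 0)"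
        using \<open>l \<in> {..<k}\<close> by (simp add: d[of l] sum_distrib_left mult.assoc flip: sum.inter_filter)
    qed
    also have "\<dots> = (\<Sum>m<k. (\<Sum>l<k. if m \<le> l then ?p l * d l m else 0) * X (i,m))"
      by (subst sum.swap) (simp add: sum_distrib_right if_distrib[of "\<lambda>x. x * _"] cong: if_cong)
    also have "\<dots> = (\<Sum>m<k. - (c m * X (i,m)))"
      by (intro sum.cong) (auto simp: c_def)
    finally show ?thesis
      by (simp add: gs_res_def sum_negf c_def[of k] flip: lessThan_Suc_atMost)
  qed
  then show ?case
    by (intro exI[of _ c]) (simp add: c_def)
qed

text \<open>Matrices close to the identity are diagonally dominant, so their columns are independent.\<close>

lemma gs_regular_near_identity:
  assumes X: "\<And>i j. i < n \<Longrightarrow> j < n \<Longrightarrow> \<bar>X (i,j) - (if i = j then 1 else 0)\<bar> \<le> e"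
    and e: "real (n + 1) * e < 1"
  shows "gs_regular n X"
  unfolding gs_regular_def
proof (intro ballI notI)
  fix k assume k: "k \<in> {..<n}" and z: "(\<Sum>m<n. (gs_res n X k m)\<^sup>2) = 0"
  have z: "gs_res n X k m = 0" if "m < n" for m
    using z that by (subst (asm) sum_nonneg_eq_0_iff) auto
  obtain c where ck: "c k = 1" and c: "\<And>i. gs_res n X k i = (\<Sum>l\<le>k. c l * X (i,l))"
    using gs_res_combination[of k n X] by blast
  \<comment> \<open>Diagonal dominance is applied in the row p where the coefficient is largest:
    there the diagonal contributes \<open>c p\<close>, and the deviations from the identity sum to
    at most M (n + 1) e < M.\<close>
  define M where "M = Max ((\<lambda>l. \<bar>c l\<bar>) ` {..k})"
  have "M \<in> (\<lambda>l. \<bar>c l\<bar>) ` {..k}"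
    unfolding M_def by (intro Max_in) auto
  then obtain p where p: "p \<le> k" "M = \<bar>c p\<bar>" by auto
  have M: "\<bar>c l\<bar> \<le> M" if "l \<le> k" for l
    unfolding M_def using that by (intro Max_ge) auto
  have M1: "M \<ge> 1" using M[of k] ck by simp
  have e0: "e \<ge> 0" using X[of k k] k by simp
  have pn: "p < n" using p k by auto
  have "0 = (\<Sum>l\<le>k. c l * X (p,l))"
    using z[OF pn] by (simp add: c)
  also have "\<dots> = (\<Sum>l\<le>k. c l * (X (p,l) - (if p = l then 1 else 0))) + (\<Sum>l\<le>k. if p = l then c l else 0)"
    unfolding sum.distrib[symmetric] by (intro sum.cong) (auto simp: algebra_simps)
  also have "(\<Sum>l\<le>k. if p = l then c l else 0) = c p"
    using p by simp
  finally have "M = \<bar>\<Sum>l\<le>k. c l * (X (p,l) - (if p = l then 1 else 0))\<bar>"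
    using p by simp
  also have "\<dots> \<le> (\<Sum>l\<le>k. \<bar>c l * (X (p,l) - (if p = l then 1 else 0))\<bar>)"
    by (rule sum_abs)
  also have "\<dots> \<le> (\<Sum>l\<le>k. M * e)"
  proof (rule sum_mono)
    fix l assume "l \<in> {..k}"
    then show "\<bar>c l * (X (p,l) - (if p = l then 1 else 0))\<bar> \<le> M * e"
      unfolding abs_mult using M M1 X[OF pn, of l] k by (intro mult_mono) auto
  qed
  also have "\<dots> = M * (real (k + 1) * e)"
    by simp
  also have "\<dots> \<le> M * (real (n + 1) * e)"
    using k M1 e0 by (intro mult_left_mono mult_right_mono) auto
  also have "\<dots> < M * 1"
    using e M1 by (intro mult_strict_left_mono) auto
  finally show False by simp
qed

text \<open>A box around the identity has positive volume and, with (n + 1) e = 1/2, contains only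
  regular matrices. Its n^2 entries are at most 2 in absolute value, hence the bound 4 n^2.\<close>

lemma gs_regular_ball_pos:
  "0 < emeasure (leb n) {X \<in> space (leb n). normsq n X \<le> 4 * (real n)\<^sup>2 \<and> gs_regular n X}"
proof -
  define e where "e = 1 / (2 * real (n + 1))"
  have e: "e > 0" "e \<le> 1" "real (n + 1) * e < 1"
    by (auto simp: e_def field_simps)
  let ?I = "\<lambda>p. {(if fst p = snd p then 1 else 0) - e..(if fst p = snd p then 1 else 0) + e :: real}"
  have "emeasure (leb n) (Pi\<^sub>E (idx n) ?I) = (\<Prod>p\<in>idx n. emeasure lborel (?I p))"
    by (intro leb.emeasure_PiM) auto
  also have "\<dots> = (\<Prod>p\<in>idx n. ennreal (2 * e))"
    using e by (intro prod.cong) auto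
  also have "\<dots> > 0"
    using e by (simp add: ennreal_power)
  finally have "0 < emeasure (leb n) (Pi\<^sub>E (idx n) ?I)" .
  also have "\<dots> \<le> emeasure (leb n) {X \<in> space (leb n). normsq n X \<le> 4 * (real n)\<^sup>2 \<and> gs_regular n X}"
  proof (intro emeasure_mono subsetI)
    fix X assume X: "X \<in> Pi\<^sub>E (idx n) ?I"
    have 1: "\<bar>X (i,j) - (if i = j then 1 else 0)\<bar> \<le> e" if "i < n" "j < n" for i j
      using PiE_mem[OF X, of "(i,j)"] that by auto
    have "(X (i,j))\<^sup>2 \<le> 2\<^sup>2" if "i < n" "j < n" for i j
      using 1[OF that] e by (intro abs_le_square_iff[THEN iffD1]) (auto split: if_splits)
    then have "normsq n X \<le> (\<Sum>j<n. \<Sum>i<n. 4)"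
      unfolding normsq_def by (intro sum_mono) auto
    then have "normsq n X \<le> 4 * (real n)\<^sup>2"
      by (simp add: power2_eq_square)
    moreover have "gs_regular n X"
      using 1 e(3) by (rule gs_regular_near_identity)
    ultimately show "X \<in> {X \<in> space (leb n). normsq n X \<le> 4 * (real n)\<^sup>2 \<and> gs_regular n X}"
      using X by (simp add: space_leb PiE_def)
  qed measurable
  finally show ?thesis .
qed

section \<open>Haar measure on the orthogonal group\<close>

definition is_haar :: "nat \<Rightarrow> (nat \<times> nat \<Rightarrow> real) measure \<Rightarrow> bool" where
  "is_haar n M \<longleftrightarrow> sets M = sets (leb n) \<and> prob_space M \<and> (AE U in M. U \<in> orth n)
      \<and> (\<forall>V\<in>orth n. distr M M (mmul n V) = M)"

text \<open>The uniform measure on G is invariant because norm, regularity and volume are;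
  Gram--Schmidt commutes with left multiplication and so transports the invariance. As G contains
  only regular matrices, its image lies in \<open>orth n\<close>. Positivity of G also makes the
  ball positive, as \<open>distr_leb_mmul\<close> requires.\<close>

lemma haar_exists: "\<exists>M. is_haar n M"
proof -
  define G where "G = {X \<in> space (leb n). normsq n X \<le> 4 * (real n)\<^sup>2 \<and> gs_regular n X}"
  let ?B = "{X \<in> space (leb n). normsq n X \<le> 4 * (real n)\<^sup>2}"
  have G [measurable]: "G \<in> sets (leb n)"
    unfolding G_def by measurable
  have G0: "0 < emeasure (leb n) G"
    unfolding G_def by (rule gs_regular_ball_pos)
  have GB: "emeasure (leb n) G \<le> emeasure (leb n) ?B"
    unfolding G_def by (intro emeasure_mono) auto
  have G1: "emeasure (leb n) G < \<infinity>"
    using GB normsq_leb_finite by (rule le_less_trans)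
  have B0: "0 < emeasure (leb n) ?B"
    using G0 GB by (rule less_le_trans)
  define P where "P = uniform_measure (leb n) G"
  have sP [measurable_cong]: "sets P = sets (leb n)" and spP: "space P = space (leb n)"
    by (auto simp: P_def)
  interpret P: prob_space P
    unfolding P_def using G0 G1 by (intro prob_space_uniform_measure) auto
  have mV [measurable]: "mmul n V \<in> measurable (leb n) (leb n)" if "V \<in> orth n" for V
    using orth_extensional[OF that] by (intro measurable_mmul) (auto simp: space_leb)
  have PV: "distr P (leb n) (mmul n V) = P" if V: "V \<in> orth n" for V
  proof (rule measure_eqI)
    fix E assume "E \<in> sets (distr P (leb n) (mmul n V))"
    then have [measurable]: "E \<in> sets (leb n)" by simp
    note [measurable] = mV[OF V]
    have "emeasure (distr P (leb n) (mmul n V)) E = emeasure P (mmul n V -` E \<inter> space (leb n))"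
      by (simp add: emeasure_distr spP)
    also have "\<dots> = emeasure (leb n) (G \<inter> (mmul n V -` E \<inter> space (leb n))) / emeasure (leb n) G"
      unfolding P_def by (intro emeasure_uniform_measure) auto
    also have "G \<inter> (mmul n V -` E \<inter> space (leb n)) = mmul n V -` (G \<inter> E) \<inter> space (leb n)"
      by (auto simp: G_def normsq_mmul[OF V] gs_regular_mmul[OF V] space_leb)
    also have "emeasure (leb n) \<dots> = emeasure (distr (leb n) (leb n) (mmul n V)) (G \<inter> E)"
      by (simp add: emeasure_distr)
    also have "\<dots> = emeasure (leb n) (G \<inter> E)"
      by (simp add: distr_leb_mmul[OF V B0])
    also have "\<dots> / emeasure (leb n) G = emeasure P E"
      unfolding P_def by (intro emeasure_uniform_measure[symmetric]) auto
    finally show "emeasure (distr P (leb n) (mmul n V)) E = emeasure P E" .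
  qed (simp add: sP)
  have "is_haar n (distr P (leb n) (gs_mat n))"
    unfolding is_haar_def
  proof (intro conjI ballI)
    show "prob_space (distr P (leb n) (gs_mat n))"
      by (intro P.prob_space_distr) measurable
    have "AE X in P. gs_mat n X \<in> orth n"
      unfolding P_def by (intro AE_uniform_measureI AE_I2) (auto simp: G_def gs_mat_orth)
    then show "AE U in distr P (leb n) (gs_mat n). U \<in> orth n"
      by (subst AE_distr_iff) auto
    fix V assume V: "V \<in> orth n"
    note [measurable] = mV[OF V]
    have "distr (distr P (leb n) (gs_mat n)) (distr P (leb n) (gs_mat n)) (mmul n V)
        = distr (distr P (leb n) (gs_mat n)) (leb n) (mmul n V)"
      by (intro distr_cong) auto
    also have "\<dots> = distr P (leb n) (mmul n V \<circ> gs_mat n)"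
      by (subst distr_distr) auto
    also have "mmul n V \<circ> gs_mat n = gs_mat n \<circ> mmul n V"
      by (auto simp: fun_eq_iff gs_mat_mmul[OF V])
    also have "distr P (leb n) \<dots> = distr (distr P (leb n) (mmul n V)) (leb n) (gs_mat n)"
      by (subst distr_distr) auto
    also have "\<dots> = distr P (leb n) (gs_mat n)"
      by (simp add: PV[OF V])
    finally show "distr (distr P (leb n) (gs_mat n)) (distr P (leb n) (gs_mat n)) (mmul n V)
        = distr P (leb n) (gs_mat n)" .
  qed simp
  then show ?thesis by blast
qed

text \<open>Averaging \<open>f(W\<^sup>T U)\<close> over both variables, in either order, identifies every left-invariant
  measure with the transpose of every other one; this yields uniqueness and right invariance at once.\<close>

lemma is_haar_mtrans:
  assumes "is_haar n M" "is_haar n N"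
  shows "M = distr N (leb n) (mtrans n)"
proof (rule measure_eqI)
  have sM [measurable_cong]: "sets M = sets (leb n)" and sN [measurable_cong]: "sets N = sets (leb n)"
    using assms by (auto simp: is_haar_def)
  interpret M: prob_space M using assms by (simp add: is_haar_def)
  interpret N: prob_space N using assms by (simp add: is_haar_def)
  interpret pair_sigma_finite N M ..
  have inv: "(\<integral>\<^sup>+U. f (mmul n V U) \<partial>L) = (\<integral>\<^sup>+U. f U \<partial>L)"
    if L: "is_haar n L" and V: "V \<in> orth n" and f: "f \<in> borel_measurable (leb n)" for f V L
  proof -
    note f [measurable]
    have sL [measurable_cong]: "sets L = sets (leb n)" using L by (simp add: is_haar_def)
    have V' [simp]: "V \<in> space (leb n)"
      using orth_extensional[OF V] by (auto simp: space_leb)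
    have "(\<integral>\<^sup>+U. f U \<partial>L) = (\<integral>\<^sup>+U. f U \<partial>distr L L (mmul n V))"
      using L V by (simp add: is_haar_def)
    also have "\<dots> = (\<integral>\<^sup>+U. f (mmul n V U) \<partial>L)"
      by (intro nn_integral_distr) measurable
    finally show ?thesis ..
  qed
  fix E assume "E \<in> sets M"
  then have E [measurable]: "E \<in> sets (leb n)" by (simp add: sM)
  let ?f = "indicator E :: _ \<Rightarrow> ennreal"
  have "emeasure M E = (\<integral>\<^sup>+W. (\<integral>\<^sup>+U. ?f U \<partial>M) \<partial>N)"
    using \<open>E \<in> sets M\<close> by (simp add: N.emeasure_space_1)
  also have "\<dots> = (\<integral>\<^sup>+W. (\<integral>\<^sup>+U. ?f (mmul n (mtrans n W) U) \<partial>M) \<partial>N)"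
  proof (rule nn_integral_cong_AE)
    have "AE W in N. W \<in> orth n" using assms by (simp add: is_haar_def)
    then show "AE W in N. (\<integral>\<^sup>+U. ?f U \<partial>M) = (\<integral>\<^sup>+U. ?f (mmul n (mtrans n W) U) \<partial>M)"
      by eventually_elim (intro inv[OF assms(1), symmetric] orth_mtrans, auto)
  qed
  also have "\<dots> = (\<integral>\<^sup>+U. (\<integral>\<^sup>+W. ?f (mmul n (mtrans n W) U) \<partial>N) \<partial>M)"
    by (intro Fubini'[symmetric]) measurable
  also have "\<dots> = (\<integral>\<^sup>+U. (\<integral>\<^sup>+W. ?f (mtrans n W) \<partial>N) \<partial>M)"
  proof (rule nn_integral_cong_AE)
    have "AE U in M. U \<in> orth n" using assms by (simp add: is_haar_def)
    then show "AE U in M. (\<integral>\<^sup>+W. ?f (mmul n (mtrans n W) U) \<partial>N) = (\<integral>\<^sup>+W. ?f (mtrans n W) \<partial>N)"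
    proof eventually_elim
      case (elim U)
      \<comment> \<open>W^T U is the transpose of U^T W, so left invariance of N under U^T removes
        U.\<close>
      have "(\<integral>\<^sup>+W. ?f (mtrans n W) \<partial>N) = (\<integral>\<^sup>+W. ?f (mtrans n (mmul n (mtrans n U) W)) \<partial>N)"
        by (intro inv[OF assms(2) orth_mtrans[OF elim], symmetric]) auto
      then show ?case
        by (simp add: mtrans_mmul mtrans_mtrans orth_extensional[OF elim])
    qed
  qed
  also have "\<dots> = (\<integral>\<^sup>+W. ?f (mtrans n W) \<partial>N)"
    by (simp add: M.emeasure_space_1)
  also have "\<dots> = (\<integral>\<^sup>+W. ?f W \<partial>distr N (leb n) (mtrans n))"
    by (intro nn_integral_distr[symmetric]) measurable
  also have "\<dots> = emeasure (distr N (leb n) (mtrans n)) E"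
    by simp
  finally show "emeasure M E = emeasure (distr N (leb n) (mtrans n)) E" .
qed (use assms in \<open>simp add: is_haar_def\<close>)

text \<open>With a fixed second measure, \<open>is_haar_mtrans\<close> exhibits every candidate as
  the same pushforward; this uniqueness gives the definite description its meaning.\<close>

lemma is_haar_haar: "is_haar n (haar n)"
proof -
  obtain M where M: "is_haar n M"
    using haar_exists by blast
  have "is_haar n (THE M. is_haar n M)"
    using M is_haar_mtrans by (intro theI[of "is_haar n" M]) metis+
  then show ?thesis
    unfolding haar_def is_haar_def .
qed

lemma sets_haar [measurable_cong]: "sets (haar n) = sets (leb n)"
  and prob_space_haar: "prob_space (haar n)"
  and AE_haar_orth: "AE U in haar n. U \<in> orth n"
  and distr_haar_mmul: "V \<in> orth n \<Longrightarrow> distr (haar n) (haar n) (mmul n V) = haar n"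
  using is_haar_haar[of n] by (auto simp: is_haar_def)

lemma integral_haar_mmul_left:
  fixes f :: "(nat \<times> nat \<Rightarrow> real) \<Rightarrow> real"
  assumes V: "V \<in> orth n" and [measurable]: "f \<in> borel_measurable (leb n)"
  shows "(\<integral>U. f (mmul n V U) \<partial>haar n) = (\<integral>U. f U \<partial>haar n)"
proof -
  have V' [simp]: "V \<in> space (leb n)"
    using orth_extensional[OF V] by (auto simp: space_leb)
  have "(\<integral>U. f U \<partial>haar n) = (\<integral>U. f U \<partial>distr (haar n) (haar n) (mmul n V))"
    by (simp add: distr_haar_mmul V)
  also have "\<dots> = (\<integral>U. f (mmul n V U) \<partial>haar n)"
    by (intro integral_distr) measurable
  finally show ?thesis ..
qed

lemma integral_haar_mtrans:
  fixes f :: "(nat \<times> nat \<Rightarrow> real) \<Rightarrow> real"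
  assumes [measurable]: "f \<in> borel_measurable (leb n)"
  shows "(\<integral>U. f (mtrans n U) \<partial>haar n) = (\<integral>U. f U \<partial>haar n)"
proof -
  have "(\<integral>U. f U \<partial>haar n) = (\<integral>U. f U \<partial>distr (haar n) (leb n) (mtrans n))"
    using is_haar_mtrans[OF is_haar_haar is_haar_haar] by metis
  also have "\<dots> = (\<integral>U. f (mtrans n U) \<partial>haar n)"
    by (intro integral_distr) measurable
  finally show ?thesis ..
qed

text \<open>Permutations and rotations of columns are right multiplications; transposition turns
  them into left ones.\<close>

lemma integral_haar_mmul_right:
  fixes f :: "(nat \<times> nat \<Rightarrow> real) \<Rightarrow> real"
  assumes V: "V \<in> orth n" and f [measurable]: "f \<in> borel_measurable (leb n)"
  shows "(\<integral>U. f (mmul n U V) \<partial>haar n) = (\<integral>U. f U \<partial>haar n)"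
proof -
  have V' [simp]: "V \<in> space (leb n)"
    using orth_extensional[OF V] by (auto simp: space_leb)
  have "(\<integral>U. f (mmul n U V) \<partial>haar n) = (\<integral>U. f (mmul n (mtrans n U) V) \<partial>haar n)"
    by (rule integral_haar_mtrans[symmetric]) measurable
  also have "\<dots> = (\<integral>U. f (mtrans n (mmul n (mtrans n V) U)) \<partial>haar n)"
    by (simp add: mtrans_mmul mtrans_mtrans orth_extensional[OF V])
  also have "\<dots> = (\<integral>U. f (mtrans n U) \<partial>haar n)"
    by (rule integral_haar_mmul_left[OF orth_mtrans[OF V]]) measurable
  also have "\<dots> = (\<integral>U. f U \<partial>haar n)"
    by (rule integral_haar_mtrans[OF f])
  finally show ?thesis .
qed

section \<open>Symmetries of the two-row integrals\<close>

lemma abs_orth_entry_le_1: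
  assumes "U \<in> orth n" "i < n" "j < n"
  shows "\<bar>U (i,j)\<bar> \<le> 1"
proof -
  have "(U (i,j))\<^sup>2 \<le> (\<Sum>k<n. (U (i,k))\<^sup>2)"
    using assms by (intro member_le_sum) auto
  also have "\<dots> = 1"
    using assms by (simp add: orth_def power2_eq_square)
  finally show ?thesis
    by (simp add: abs_square_le_1)
qed

lemma integrable_haar_monomial:
  assumes "2 \<le> n" "finite A" "A \<subseteq> {..<n}"
  shows "integrable (haar n) (\<lambda>U. \<Prod>j\<in>A. U (0,j) ^ a j * U (1,j) ^ b j)"
proof -
  interpret prob_space "haar n" by (rule prob_space_haar)
  show ?thesis
  proof (rule integrable_const_bound[where B=1])
    show "AE U in haar n. norm (\<Prod>j\<in>A. U (0,j) ^ a j * U (1,j) ^ b j) \<le> 1"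
      using AE_haar_orth
    proof eventually_elim
      case (elim U)
      have "\<bar>U (0,j)\<bar> ^ a j * \<bar>U (1,j)\<bar> ^ b j \<le> 1" if "j \<in> A" for j
        using abs_orth_entry_le_1[OF elim, of 0 j] abs_orth_entry_le_1[OF elim, of 1 j] assms that
        by (intro mult_le_one power_le_one) auto
      then show ?case
        by (auto simp: abs_prod abs_mult power_abs intro!: prod_le_1)
    qed
  qed measurable
qed

text \<open>Padding with zero columns up to n makes the free columns of U available as targets for
  splitting.\<close>

lemma I_int_extend:
  assumes "q \<le> n"
  shows "I_int n q a b = I_int n n (\<lambda>j. if j < q then a j else 0) (\<lambda>j. if j < q then b j else 0)"
proof -
  have "(\<Prod>j<q. U (0,j) ^ a j * U (1,j) ^ b j)
    = (\<Prod>j<n. U (0,j) ^ (if j < q then a j else 0) * U (1,j) ^ (if j < q then b j else 0))" for U :: "nat \<times> nat \<Rightarrow> real"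
    using assms by (intro prod.mono_neutral_cong_left) auto
  then show ?thesis
    by (simp add: I_int_def)
qed

lemma I_int_cong:
  "(\<And>j. j < q \<Longrightarrow> a j = a' j) \<Longrightarrow> (\<And>j. j < q \<Longrightarrow> b j = b' j) \<Longrightarrow> I_int n q a b = I_int n q a' b'"
  unfolding I_int_def by (auto intro!: Bochner_Integration.integral_cong prod.cong)

lemma I_int_permute:
  assumes n: "2 \<le> n" and p: "p permutes {..<n}"
  shows "I_int n n (\<lambda>j. a (p j)) (\<lambda>j. b (p j)) = I_int n n a b"
proof -
  define V where "V = (\<lambda>(k,j)\<in>idx n. if k = p j then 1 else 0 :: real)"
  have pn: "p j < n" if "j < n" for j
    using permutes_in_image[OF p, of j] that by auto
  have V: "V \<in> orth n"
  proof -
    have "mtrans n V \<in> orth n"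
      unfolding orth_def
    proof (intro CollectI conjI allI impI)
      fix i j assume ij: "i < n" "j < n"
      have "(\<Sum>k<n. mtrans n V (i,k) * mtrans n V (j,k)) = (\<Sum>k<n. if k = p i then (if p i = p j then 1 else 0) else 0)"
        using ij by (intro sum.cong) (auto simp: V_def)
      also have "\<dots> = (if i = j then 1 else 0)"
        using pn[OF ij(1)] permutes_inj[OF p] by (auto simp: inj_eq)
      finally show "(\<Sum>k<n. mtrans n V (i,k) * mtrans n V (j,k)) = (if i = j then 1 else 0)" .
    qed (auto simp: PiE_def)
    from orth_mtrans[OF this] show ?thesis
      by (simp add: mtrans_mtrans V_def)
  qed
  have UV: "mmul n U V (i,j) = U (i, p j)" if "i < n" "j < n" for U i j
    using that pn[OF that(2)] by (simp add: V_def if_distrib[of "\<lambda>x. _ * x"] cong: if_cong)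
  have "I_int n n (\<lambda>j. a (p j)) (\<lambda>j. b (p j))
     = (\<integral>U. (\<Prod>j<n. mmul n U V (0,j) ^ a (p j) * mmul n U V (1,j) ^ b (p j)) \<partial>haar n)"
    unfolding I_int_def
    by (rule integral_haar_mmul_right[OF V, symmetric,
          where f="\<lambda>U. \<Prod>j<n. U (0,j) ^ a (p j) * U (1,j) ^ b (p j)"]) measurable
  also have "\<dots> = (\<integral>U. (\<Prod>j<n. U (0,p j) ^ a (p j) * U (1,p j) ^ b (p j)) \<partial>haar n)"
    using n by (intro Bochner_Integration.integral_cong prod.cong refl) (auto simp: UV simp del: mmul_apply)
  also have "\<dots> = I_int n n a b"
    unfolding I_int_def
    by (intro Bochner_Integration.integral_cong prod.reindex_bij_betw[OF permutes_imp_bij[OF p],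
          where g="\<lambda>j. _ (0,j) ^ a j * _ (1,j) ^ b j"] refl)
  finally show ?thesis .
qed

text \<open>Rotation by the angle \<open>arctan t\<close> in the plane of the columns \<open>i\<close> and \<open>j\<close>.\<close>

lemma I_int_rotate:
  fixes t :: real
  assumes n: "2 \<le> n" and ij: "i < n" "j < n" "i \<noteq> j"
    and j0: "a j = 0" "b j = 0" and m: "a i + b i = 2 * m"
  shows "(\<integral>U. (U (0,i) + t * U (0,j)) ^ a i * (U (1,i) + t * U (1,j)) ^ b i
           * (\<Prod>l\<in>{..<n} - {i,j}. U (0,l) ^ a l * U (1,l) ^ b l) \<partial>haar n)
         = (1 + t\<^sup>2) ^ m * I_int n n a b"
proof -
  \<comment> \<open>c is the cosine and c t the sine of the angle. The factor c leaves the monomial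
    with the even exponent 2m, so its square root disappears.\<close>
  define c where "c = 1 / sqrt (1 + t\<^sup>2)"
  have t0: "1 + t\<^sup>2 > 0"
    by (simp add: add_pos_nonneg)
  have c2: "c\<^sup>2 = 1 / (1 + t\<^sup>2)"
    using t0 by (simp add: c_def power_divide)
  have cs: "c * c + (c * t) * (c * t) = 1"
  proof -
    have "c * c + (c * t) * (c * t) = c\<^sup>2 * (1 + t\<^sup>2)"
      by (simp add: power2_eq_square algebra_simps)
    then show ?thesis using t0 by (simp add: c2)
  qed
  define V where "V = (\<lambda>(k,l)\<in>idx n.
     if l = i then (if k = i then c else 0) + (if k = j then c * t else 0)
     else if l = j then (if k = i then - (c * t) else 0) + (if k = j then c else 0)
     else if k = l then 1 else 0)"
  \<comment> \<open>For g a row of U this computes UV; for g a column of V it gives the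
    orthogonality relations of V.\<close>
  have col: "(\<Sum>k<n. g k * V (k,l)) =
      (if l = i then g i * c + g j * (c * t) else if l = j then g i * - (c * t) + g j * c else g l)"
    if "l < n" for l and g :: "nat \<Rightarrow> real"
    using ij that
    by (simp add: V_def distrib_left sum.distrib if_distrib[of "\<lambda>x. _ * x"] cong: if_cong)
  have V: "V \<in> orth n"
  proof -
    have "mtrans n V \<in> orth n"
      unfolding orth_def
    proof (intro CollectI conjI allI impI)
      fix k l assume kl: "k < n" "l < n"
      have "(\<Sum>r<n. mtrans n V (k,r) * mtrans n V (l,r)) = (\<Sum>r<n. V (r,k) * V (r,l))"
        using kl by simp
      also have "\<dots> = (if k = l then 1 else 0)"
        using kl ij cs
        by (cases "k = i"; cases "k = j"; cases "l = i"; cases "l = j"; simp add: col; simp add: V_def algebra_simps)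
      finally show "(\<Sum>r<n. mtrans n V (k,r) * mtrans n V (l,r)) = (if k = l then 1 else 0)" .
    qed (auto simp: PiE_def)
    from orth_mtrans[OF this] show ?thesis
      by (simp add: mtrans_mtrans V_def)
  qed
  let ?f = "\<lambda>U. U (0,i) ^ a i * U (1,i) ^ b i * (\<Prod>l\<in>{..<n} - {i,j}. U (0,l) ^ a l * U (1,l) ^ b l) :: real"
  let ?g = "\<lambda>U. (U (0,i) + t * U (0,j)) ^ a i * (U (1,i) + t * U (1,j)) ^ b i
           * (\<Prod>l\<in>{..<n} - {i,j}. U (0,l) ^ a l * U (1,l) ^ b l) :: real"
  have f: "(\<Prod>l<n. U (0,l) ^ a l * U (1,l) ^ b l) = ?f U" for U :: "nat \<times> nat \<Rightarrow> real"
  proof -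
    have "(\<Prod>l<n. U (0,l) ^ a l * U (1,l) ^ b l) = (\<Prod>l\<in>insert i (insert j ({..<n} - {i,j})). U (0,l) ^ a l * U (1,l) ^ b l)"
      using ij by (intro prod.cong) auto
    then show ?thesis
      using ij j0 by simp
  qed
  have fV: "?f (mmul n U V) = c ^ (2 * m) * ?g U" for U
  proof -
    have "?f (mmul n U V) = (c * (U (0,i) + t * U (0,j))) ^ a i * (c * (U (1,i) + t * U (1,j))) ^ b i
        * (\<Prod>l\<in>{..<n} - {i,j}. U (0,l) ^ a l * U (1,l) ^ b l)"
      using n ij by (intro arg_cong2[where f="(*)"] arg_cong2[where f="(^)"] prod.cong refl;
          auto simp: col; auto simp: algebra_simps)
    also have "\<dots> = c ^ (a i + b i) * ?g U"
      by (simp add: power_mult_distrib power_add mult_ac)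
    finally show ?thesis by (simp add: m)
  qed
  have "I_int n n a b = (\<integral>U. ?f U \<partial>haar n)"
    unfolding I_int_def by (simp only: f)
  also have "\<dots> = (\<integral>U. ?f (mmul n U V) \<partial>haar n)"
    by (rule integral_haar_mmul_right[OF V, symmetric, where f="?f"]) measurable
  also have "\<dots> = c ^ (2 * m) * (\<integral>U. ?g U \<partial>haar n)"
    by (simp only: fV) simp
  also have "c ^ (2 * m) = 1 / (1 + t\<^sup>2) ^ m"
    by (simp add: power_mult c2 power_divide)
  finally show ?thesis
    using t0 by (simp add: field_simps)
qed

text \<open>Multiplication by 1 + t^2 adds the coefficient at 0 to the one at 2, so the lower
  coefficients join the induction.\<close>

lemma coeff_one_plus_square_power:
  "coeff ([:1, 0, 1:] ^ m :: real poly) 0 = 1 \<and> coeff ([:1, 0, 1:] ^ m :: real poly) 1 = 0 \<and>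
   coeff ([:1, 0, 1:] ^ m :: real poly) 2 = real m"
  by (induction m) (auto simp: coeff_pCons numeral_2_eq_2)

text \<open>Comparing the coefficients of \<open>t\<^sup>2\<close> in the rotation identity moves two factors from column \<open>i\<close>
  to the empty column \<open>j\<close>.\<close>

lemma I_int_split:
  assumes n: "2 \<le> n" and ij: "i < n" "j < n" "i \<noteq> j"
    and j0: "a j = 0" "b j = 0" and m: "a i + b i = 2 * m"
  shows "real m * I_int n n a b =
      real (a i choose 2) * I_int n n (a(i := a i - 2, j := 2)) b
    + real (a i * b i) * I_int n n (a(i := a i - 1, j := 1)) (b(i := b i - 1, j := 1))
    + real (b i choose 2) * I_int n n a (b(i := b i - 2, j := 2))"
proof -
  define M where "M p r = I_int n n (a(i := a i - p, j := p)) (b(i := b i - r, j := r))" for p r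
  define w where "w p r = real (a i choose p) * real (b i choose r) * M p r" for p r
  have M: "M p r = (\<integral>U. U (0,i) ^ (a i - p) * U (0,j) ^ p * U (1,i) ^ (b i - r) * U (1,j) ^ r
           * (\<Prod>l\<in>{..<n} - {i,j}. U (0,l) ^ a l * U (1,l) ^ b l) \<partial>haar n)"
    and int: "integrable (haar n) (\<lambda>U. U (0,i) ^ (a i - p) * U (0,j) ^ p * U (1,i) ^ (b i - r) * U (1,j) ^ r
           * (\<Prod>l\<in>{..<n} - {i,j}. U (0,l) ^ a l * U (1,l) ^ b l))" for p r
  proof -
    let ?a = "a(i := a i - p, j := p)" and ?b = "b(i := b i - r, j := r)"
    have *: "(\<Prod>l<n. U (0,l) ^ ?a l * U (1,l) ^ ?b l) = U (0,i) ^ (a i - p) * U (0,j) ^ p * U (1,i) ^ (b i - r) * U (1,j) ^ r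
           * (\<Prod>l\<in>{..<n} - {i,j}. U (0,l) ^ a l * U (1,l) ^ b l)" for U :: "nat \<times> nat \<Rightarrow> real"
    proof -
      have "(\<Prod>l<n. U (0,l) ^ ?a l * U (1,l) ^ ?b l) = (\<Prod>l\<in>insert i (insert j ({..<n} - {i,j})). U (0,l) ^ ?a l * U (1,l) ^ ?b l)"
        using ij by (intro prod.cong) auto
      also have "\<dots> = U (0,i) ^ (a i - p) * U (0,j) ^ p * U (1,i) ^ (b i - r) * U (1,j) ^ r
           * (\<Prod>l\<in>{..<n} - {i,j}. U (0,l) ^ ?a l * U (1,l) ^ ?b l)"
        using ij by (simp add: mult_ac)
      finally show ?thesis by simp
    qed
    show "M p r = (\<integral>U. U (0,i) ^ (a i - p) * U (0,j) ^ p * U (1,i) ^ (b i - r) * U (1,j) ^ r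
           * (\<Prod>l\<in>{..<n} - {i,j}. U (0,l) ^ a l * U (1,l) ^ b l) \<partial>haar n)"
      unfolding M_def I_int_def * ..
    show "integrable (haar n) (\<lambda>U. U (0,i) ^ (a i - p) * U (0,j) ^ p * U (1,i) ^ (b i - r) * U (1,j) ^ r
           * (\<Prod>l\<in>{..<n} - {i,j}. U (0,l) ^ a l * U (1,l) ^ b l))"
      using integrable_haar_monomial[OF n, of "{..<n}" ?a ?b] unfolding * by simp
  qed
  define L where "L = (\<Sum>p\<le>a i. \<Sum>r\<le>b i. monom (w p r) (p + r))"
  define R where "R = smult (I_int n n a b) ([:1, 0, 1:] ^ m)"
  have "poly L t = poly R t" for t
  proof -
    have "poly L t = (\<Sum>p\<le>a i. \<Sum>r\<le>b i. w p r * t ^ (p + r))"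
      by (simp add: L_def poly_sum poly_monom)
    also have "\<dots> = (\<integral>U. (\<Sum>p\<le>a i. \<Sum>r\<le>b i. (real (a i choose p) * real (b i choose r) * t ^ (p + r)) *
           (U (0,i) ^ (a i - p) * U (0,j) ^ p * U (1,i) ^ (b i - r) * U (1,j) ^ r
           * (\<Prod>l\<in>{..<n} - {i,j}. U (0,l) ^ a l * U (1,l) ^ b l))) \<partial>haar n)"
      using int by (simp add: Bochner_Integration.integral_sum w_def M mult_ac)
    also have "\<dots> = (\<integral>U. (U (0,i) + t * U (0,j)) ^ a i * (U (1,i) + t * U (1,j)) ^ b i
           * (\<Prod>l\<in>{..<n} - {i,j}. U (0,l) ^ a l * U (1,l) ^ b l) \<partial>haar n)"
    proof (intro Bochner_Integration.integral_cong refl)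
      fix U :: "nat \<times> nat \<Rightarrow> real"
      have x: "(x + t * y) ^ k = (\<Sum>p\<le>k. real (k choose p) * (t * y) ^ p * x ^ (k - p))" for x y :: real and k
        by (subst add.commute) (rule binomial_ring)
      show "(\<Sum>p\<le>a i. \<Sum>r\<le>b i. (real (a i choose p) * real (b i choose r) * t ^ (p + r)) *
           (U (0,i) ^ (a i - p) * U (0,j) ^ p * U (1,i) ^ (b i - r) * U (1,j) ^ r
           * (\<Prod>l\<in>{..<n} - {i,j}. U (0,l) ^ a l * U (1,l) ^ b l)))
        = (U (0,i) + t * U (0,j)) ^ a i * (U (1,i) + t * U (1,j)) ^ b i
           * (\<Prod>l\<in>{..<n} - {i,j}. U (0,l) ^ a l * U (1,l) ^ b l)"
        unfolding x sum_product unfolding sum_distrib_right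
        by (intro sum.cong refl) (simp add: power_mult_distrib power_add mult_ac)
    qed
    also have "\<dots> = poly R t"
      unfolding I_int_rotate[where t=t, OF n ij j0 m] R_def by (simp add: power2_eq_square)
    finally show ?thesis .
  qed
  then have "L = R"
    by (intro poly_eq_poly_eq_iff[THEN iffD1]) auto
  then have "coeff L 2 = real m * I_int n n a b"
    by (simp add: R_def coeff_one_plus_square_power)
  moreover have "coeff L 2 = w 2 0 + w 1 1 + w 0 2"
  proof -
    have "coeff L 2 = (\<Sum>p\<le>a i. \<Sum>r\<le>b i. if p + r = 2 then w p r else 0)"
      by (simp add: L_def coeff_sum)
    \<comment> \<open>Ranges are enlarged to contain 2: beyond \<open>a i\<close> or
      \<open>b i\<close> a binomial factor of \<open>w p r\<close> vanishes, so small exponents need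
      no separate treatment.\<close>
    also have "\<dots> = (\<Sum>p\<le>a i. \<Sum>r\<in>{..max 2 (b i)}. if p + r = 2 then w p r else 0)"
      by (intro sum.cong refl sum.mono_neutral_left) (auto simp: w_def)
    also have "\<dots> = (\<Sum>p\<in>{..max 2 (a i)}. \<Sum>r\<in>{..max 2 (b i)}. if p + r = 2 then w p r else 0)"
      by (intro sum.mono_neutral_left) (auto simp: w_def intro!: sum.neutral)
    also have "\<dots> = (\<Sum>p\<in>{..max 2 (a i)}. if p \<le> 2 then w p (2 - p) else 0)"
    proof (intro sum.cong refl)
      fix p
      have "(\<Sum>r\<in>{..max 2 (b i)}. if p + r = 2 then w p r else 0)
        = (\<Sum>r\<in>{..max 2 (b i)}. if r = 2 - p then (if p \<le> 2 then w p r else 0) else 0)"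
        by (intro sum.cong) auto
      also have "\<dots> = (if p \<le> 2 then w p (2 - p) else 0)"
        by (subst sum.delta) auto
      finally show "(\<Sum>r\<in>{..max 2 (b i)}. if p + r = 2 then w p r else 0) = (if p \<le> 2 then w p (2 - p) else 0)" .
    qed
    also have "\<dots> = (\<Sum>p\<le>2. w p (2 - p))"
      by (intro sum.mono_neutral_cong_right) auto
    also have "\<dots> = w 2 0 + w 1 1 + w 0 2"
      by (simp add: numeral_2_eq_2)
    finally show ?thesis .
  qed
  moreover have "a(j := 0) = a" "b(j := 0) = b" "a(i := a i, j := 0) = a" "b(i := b i, j := 0) = b"
    using j0 by auto
  ultimately show ?thesis
    by (simp add: w_def M_def)
qed

section \<open>The weight polynomials\<close>

text \<open>The number of perfect pairings of \<open>a\<close> red and \<open>b\<close> blue points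
  with exactly s mixed pairs; the condition says that such pairings exist.\<close>

definition wcoeff :: "nat \<Rightarrow> nat \<Rightarrow> nat \<Rightarrow> real" where
  "wcoeff a b s = (if s \<le> a \<and> s \<le> b \<and> even (a - s) \<and> even (b - s)
     then fact a * fact b / (2 ^ ((a - s) div 2 + (b - s) div 2) * fact s * fact ((a - s) div 2) * fact ((b - s) div 2))
     else 0)"

text \<open>The exponent of the variable counts the columns \<open>(1,1)\<^sup>T\<close> into which a column \<open>(a,b)\<^sup>T\<close> is split.\<close>

definition wpoly :: "nat \<Rightarrow> nat \<Rightarrow> real poly" where
  "wpoly a b = (\<Sum>s\<le>a. monom (wcoeff a b s) s)"

lemma coeff_wpoly: "coeff (wpoly a b) s = wcoeff a b s"
  by (auto simp: wpoly_def coeff_sum wcoeff_def)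

lemma wpoly_simps:
  "wpoly 0 0 = 1" "wpoly 2 0 = 1" "wpoly 0 2 = 1" "wpoly 1 1 = monom 1 1"
  by (auto intro!: poly_eqI simp: coeff_wpoly wcoeff_def numeral_2_eq_2 le_Suc_eq intro!: gr0I)

lemma real_choose_two: "real (a choose 2) = real a * real (a - 1) / 2"
proof -
  have "2 dvd a * (a - 1)" by (cases a) auto
  then show ?thesis by (simp add: choose_two real_of_nat_div)
qed

text \<open>Double counting of pairings with one marked pair, which is red, mixed or blue. With x
  red and y blue pairs, the three terms are x, s and y times the coefficient, and m = s + x + y.
  Truncated subtractions occur only next to vanishing factors.\<close>

lemma wcoeff_rec:
  assumes m: "a + b = 2 * m"
  shows "real m * wcoeff a b s = real (a choose 2) * wcoeff (a - 2) b s
    + real (a * b) * (if s = 0 then 0 else wcoeff (a - 1) (b - 1) (s - 1))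
    + real (b choose 2) * wcoeff a (b - 2) s"
proof (cases "s \<le> a \<and> s \<le> b \<and> even (a - s) \<and> even (b - s)")
  case True
  then obtain x y where x: "a - s = 2 * x" and y: "b - s = 2 * y"
    by (metis evenE)
  with True have a: "a = s + 2 * x" and b: "b = s + 2 * y" by auto
  have mm: "m = s + x + y" using m a b by auto
  define W where "W = wcoeff a b s"
  have W: "W = fact a * fact b / (2 ^ (x + y) * fact s * fact x * fact y)"
    by (simp add: W_def wcoeff_def a b)
  have 1: "real (a choose 2) * wcoeff (a - 2) b s = real x * W"
  proof (cases x)
    case 0
    then show ?thesis by (auto simp: wcoeff_def a binomial_eq_0_iff)
  next
    case (Suc x')
    then have a2: "a - 2 = s + 2 * x'" "a = Suc (Suc (s + 2 * x'))" by (auto simp: a)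
    have e1: "wcoeff (a - 2) b s = fact (s + 2 * x') * fact b / (2 ^ (x' + y) * fact s * fact x' * fact y)"
      by (simp add: wcoeff_def a2 b)
    have e2: "real (a choose 2) = real a * real (a - 1) / 2"
      by (rule real_choose_two)
    have e3: "fact a = real a * (real (a - 1) * fact (s + 2 * x'))"
      unfolding a2(2) by (simp add: fact_Suc)
    show ?thesis
      unfolding W e1 e2 e3 by (simp add: Suc field_simps del: of_nat_Suc)
  qed
  have 2: "real (b choose 2) * wcoeff a (b - 2) s = real y * W"
  proof (cases y)
    case 0
    then show ?thesis by (auto simp: wcoeff_def b binomial_eq_0_iff)
  next
    case (Suc y')
    then have b2: "b - 2 = s + 2 * y'" "b = Suc (Suc (s + 2 * y'))" by (auto simp: b)
    have e1: "wcoeff a (b - 2) s = fact a * fact (s + 2 * y') / (2 ^ (x + y') * fact s * fact x * fact y')"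
      by (simp add: wcoeff_def b2 a)
    have e2: "real (b choose 2) = real b * real (b - 1) / 2"
      by (rule real_choose_two)
    have e3: "fact b = real b * (real (b - 1) * fact (s + 2 * y'))"
      unfolding b2(2) by (simp add: fact_Suc)
    show ?thesis
      unfolding W e1 e2 e3 by (simp add: Suc field_simps del: of_nat_Suc)
  qed
  have 3: "real (a * b) * (if s = 0 then 0 else wcoeff (a - 1) (b - 1) (s - 1)) = real s * W"
  proof (cases s)
    case (Suc s')
    have e1: "wcoeff (a - 1) (b - 1) (s - 1) = fact (s' + 2 * x) * fact (s' + 2 * y) / (2 ^ (x + y) * fact s' * fact x * fact y)"
      by (simp add: wcoeff_def a b Suc)
    have e3: "fact a = real a * fact (s' + 2 * x)" "fact b = real b * fact (s' + 2 * y)"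
      by (simp_all add: a b Suc)
    show ?thesis
      unfolding W e1 e3 by (simp add: Suc field_simps del: of_nat_Suc)
  qed simp
  show ?thesis
    unfolding 1 2 3 W_def[symmetric] mm by (simp add: algebra_simps)
next
  case False
  have 1: "real (a choose 2) * wcoeff (a - 2) b s = 0"
  proof (cases "2 \<le> a \<and> s \<le> a - 2")
    case True
    then have "a - s = Suc (Suc (a - 2 - s))" by auto
    then show ?thesis using False True by (auto simp: wcoeff_def)
  next
    case F: False
    then show ?thesis by (cases "a < 2") (auto simp: wcoeff_def)
  qed
  have 2: "real (b choose 2) * wcoeff a (b - 2) s = 0"
  proof (cases "2 \<le> b \<and> s \<le> b - 2")
    case True
    then have "b - s = Suc (Suc (b - 2 - s))" by auto
    then show ?thesis using False True by (auto simp: wcoeff_def)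
  next
    case F: False
    then show ?thesis by (cases "b < 2") (auto simp: wcoeff_def)
  qed
  have 3: "real (a * b) * (if s = 0 then 0 else wcoeff (a - 1) (b - 1) (s - 1)) = 0"
  proof (cases "s = 0 \<or> a = 0 \<or> b = 0")
    case F: False
    then obtain a' b' s' where "a = Suc a'" "b = Suc b'" "s = Suc s'"
      by (metis not0_implies_Suc)
    then show ?thesis using False by (auto simp: wcoeff_def)
  qed auto
  show ?thesis
    unfolding 1 2 3 using False by (auto simp: wcoeff_def)
qed

lemma wpoly_rec:
  assumes "a + b = 2 * m"
  shows "smult (real m) (wpoly a b) = smult (real (a choose 2)) (wpoly (a - 2) b)
    + smult (real (a * b)) (wpoly (a - 1) (b - 1) * monom 1 1) + smult (real (b choose 2)) (wpoly a (b - 2))"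
  using wcoeff_rec[OF assms]
  by (intro poly_eqI) (auto simp: coeff_wpoly coeff_monom_mult mult.commute[of _ "monom _ _"])

section \<open>Elementary expansion\<close>

text \<open>Once the number of columns (1,1) is known, the row sums fix the numbers of (2,0) and
  (0,2), and n fixes that of (0,0). Equal multiplicities of all values give the permutation.\<close>

lemma exists_column_permutation:
  fixes f g :: "nat \<Rightarrow> nat \<times> nat"
  defines "K \<equiv> {(0,0), (2,0), (0,2), (1,1)}"
  assumes K: "\<And>j. j < n \<Longrightarrow> f j \<in> K" "\<And>j. j < n \<Longrightarrow> g j \<in> K"
    and row1: "(\<Sum>j<n. fst (f j)) = (\<Sum>j<n. fst (g j))"
    and row2: "(\<Sum>j<n. snd (f j)) = (\<Sum>j<n. snd (g j))"
    and mixed: "card {j \<in> {..<n}. f j = (1,1)} = card {j \<in> {..<n}. g j = (1,1)}"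
  shows "\<exists>p. p permutes {..<n} \<and> (\<forall>j<n. f j = g (p j))"
proof -
  define N where "N h v = card {j \<in> {..<n}. h j = v}" for h :: "nat \<Rightarrow> nat \<times> nat" and v
  have sumN: "(\<Sum>j<n. F (h j)) = F (0,0) * N h (0,0) + F (2,0) * N h (2,0) + F (0,2) * N h (0,2) + F (1,1) * N h (1,1)"
    if h: "\<And>j. j < n \<Longrightarrow> h j \<in> K" for h and F :: "nat \<times> nat \<Rightarrow> nat"
  proof -
    have "(\<Sum>j<n. F (h j)) = (\<Sum>v\<in>K. \<Sum>j\<in>{j \<in> {..<n}. h j = v}. F (h j))"
    proof (rule sum.group[symmetric])
      show "h ` {..<n} \<subseteq> K" using h by auto
    qed (auto simp: K_def)
    also have "\<dots> = (\<Sum>v\<in>K. F v * N h v)"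
      by (intro sum.cong refl) (simp add: N_def mult.commute)
    finally show ?thesis
      by (simp add: K_def)
  qed
  have N11: "N f (1,1) = N g (1,1)"
    using mixed by (simp add: N_def)
  have N20: "N f (2,0) = N g (2,0)"
    using row1 N11 by (simp add: sumN[of f fst] sumN[of g fst] K)
  have N02: "N f (0,2) = N g (0,2)"
    using row2 N11 by (simp add: sumN[of f snd] sumN[of g snd] K)
  have N00: "N f (0,0) = N g (0,0)"
    using sumN[of f "\<lambda>_. 1"] sumN[of g "\<lambda>_. 1"] K N11 N20 N02 by simp
  have "N f v = N g v" for v
  proof (cases "v \<in> K")
    case True
    then show ?thesis using N00 N20 N02 N11 by (auto simp: K_def)
  next
    case False
    then have "{j \<in> {..<n}. f j = v} = {}" "{j \<in> {..<n}. g j = v} = {}"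
      using K by auto
    then show ?thesis by (simp only: N_def)
  qed
  then have "image_mset f (mset_set {..<n}) = image_mset g (mset_set {..<n})"
    by (intro multiset_eqI) (simp add: count_image_mset' N_def eq_commute)
  from image_mset_eq_implies_permutes[OF finite_lessThan this] show ?thesis
    by (metis lessThan_iff)
qed

text \<open>The bound k covers both the matrix padded to n columns and, for k = s + x + y, the bare
  row sums in \<open>PhiE\<close>.\<close>

lemma sum_E_row:
  assumes "s + x + y \<le> k"
  shows "(\<Sum>j<k. if j < s + x + y then E_row1 s x j else 0) = s + 2 * x"
    and "(\<Sum>j<k. if j < s + x + y then E_row2 s x j else 0) = s + 2 * y"
proof -
  have *: "(\<Sum>j<k. if j < s + x + y then F j else 0) = (\<Sum>j<s. F j) + (\<Sum>j\<in>{s..<s+x}. F j) + (\<Sum>j\<in>{s+x..<s+x+y}. F j)"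
    for F :: "nat \<Rightarrow> nat"
  proof -
    have "(\<Sum>j<k. if j < s + x + y then F j else 0) = (\<Sum>j<s+x+y. F j)"
      using assms by (intro sum.mono_neutral_cong_right) auto
    also have "{..<s+x+y} = {..<s} \<union> {s..<s+x} \<union> {s+x..<s+x+y}"
      by auto
    also have "sum F \<dots> = (\<Sum>j<s. F j) + (\<Sum>j\<in>{s..<s+x}. F j) + (\<Sum>j\<in>{s+x..<s+x+y}. F j)"
      by (subst sum.union_disjoint; (subst sum.union_disjoint)?; auto)
    finally show ?thesis .
  qed
  show "(\<Sum>j<k. if j < s + x + y then E_row1 s x j else 0) = s + 2 * x"
    unfolding * by (simp add: E_row1_def)
  show "(\<Sum>j<k. if j < s + x + y then E_row2 s x j else 0) = s + 2 * y"
    unfolding * by (simp add: E_row2_def)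
qed

text \<open>The row sums A and B force x = (A - s)/2 and y = (B - s)/2. Values of s with the wrong
  parity or beyond a row sum carry coefficient 0 in the products of \<open>wpoly\<close> considered
  here.\<close>

definition E_int :: "nat \<Rightarrow> nat \<Rightarrow> nat \<Rightarrow> nat \<Rightarrow> real" where
  "E_int n A B s = I_int n (s + (A - s) div 2 + (B - s) div 2) (E_row1 s ((A - s) div 2)) (E_row2 s ((A - s) div 2))"

text \<open>The linear functional sending the s-th power of the variable to the elementary integral
  with s mixed columns. Splitting keeps A and B, so the same functional serves throughout the
  induction.\<close>

definition E_lin :: "nat \<Rightarrow> nat \<Rightarrow> nat \<Rightarrow> real poly \<Rightarrow> real" where
  "E_lin n A B p = (\<Sum>s\<le>A. coeff p s * E_int n A B s)"

lemma E_lin_add: "E_lin n A B (p + r) = E_lin n A B p + E_lin n A B r"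
  by (simp add: E_lin_def sum.distrib distrib_right)

lemma E_lin_smult: "E_lin n A B (smult c p) = c * E_lin n A B p"
  by (simp add: E_lin_def sum_distrib_left mult.assoc)

lemma E_lin_sum: "E_lin n A B (\<Sum>x\<in>S. f x) = (\<Sum>x\<in>S. E_lin n A B (f x))"
  by (induction S rule: infinite_finite_induct) (auto simp: E_lin_add E_lin_def[of _ _ _ 0])

lemma E_lin_monom: "s \<le> A \<Longrightarrow> E_lin n A B (monom c s) = c * E_int n A B s"
  by (simp add: E_lin_def if_distrib[of "\<lambda>x. x * _"] cong: if_cong)

text \<open>Evenness leaves only elementary and empty columns. Each column (1,1) contributes one
  factor of the variable and all others contribute 1, so the product is a single power, and a
  permutation of columns brings the matrix to standard form.\<close>

lemma I_int_small_columns: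
  assumes n: "2 \<le> n" and ev: "\<And>j. j < n \<Longrightarrow> even (a j + b j)"
    and small: "\<And>j. j < n \<Longrightarrow> a j + b j \<le> 2"
    and A: "A = (\<Sum>j<n. a j)" and B: "B = (\<Sum>j<n. b j)"
  shows "I_int n n a b = E_lin n A B (\<Prod>j<n. wpoly (a j) (b j))"
proof -
  define K :: "(nat \<times> nat) set" where "K = {(0,0), (2,0), (0,2), (1,1)}"
  have K: "(a j, b j) \<in> K" if "j < n" for j
  proof -
    have "a j = 0 \<or> a j = 1 \<or> a j = 2" "b j = 0 \<or> b j = 1 \<or> b j = 2"
      using small[OF that] by linarith+
    then show ?thesis
      using small[OF that] ev[OF that] by (auto simp: K_def)
  qed
  define T where "T = {j \<in> {..<n}. (a j, b j) = (1,1)}"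
  define s where "s = card T"
  have [simp]: "finite T" by (simp add: T_def)
  have aT: "a j = (if j \<in> T then 1 else 0) + 2 * (a j div 2)" if "j < n" for j
    using K[OF that] that by (auto simp: K_def T_def)
  have bT: "b j = (if j \<in> T then 1 else 0) + 2 * (b j div 2)" if "j < n" for j
    using K[OF that] that by (auto simp: K_def T_def)
  have sT: "(\<Sum>j<n. if j \<in> T then 1 else 0) = s"
    by (simp add: s_def sum.If_cases T_def Int_def)
  have "A = (\<Sum>j<n. (if j \<in> T then 1 else 0) + 2 * (a j div 2))"
    unfolding A using aT by (intro sum.cong) auto
  then have As: "A = s + 2 * (\<Sum>j<n. a j div 2)"
    by (simp only: sum.distrib sT sum_distrib_left)
  have "B = (\<Sum>j<n. (if j \<in> T then 1 else 0) + 2 * (b j div 2))"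
    unfolding B using bT by (intro sum.cong) auto
  then have Bs: "B = s + 2 * (\<Sum>j<n. b j div 2)"
    by (simp only: sum.distrib sT sum_distrib_left)
  define x y where "x = (A - s) div 2" and "y = (B - s) div 2"
  have x: "A = s + 2 * x" and y: "B = s + 2 * y"
    using As Bs by (auto simp: x_def y_def)
  have "A + B \<le> (\<Sum>j<n. 2)"
    unfolding A B sum.distrib[symmetric] using small by (intro sum_mono) auto
  then have sxy: "s + x + y \<le> n"
    using x y by auto
  let ?g = "\<lambda>j. if j < s + x + y then (E_row1 s x j, E_row2 s x j) else (0,0)"
  have "\<exists>p. p permutes {..<n} \<and> (\<forall>j<n. (a j, b j) = ?g (p j))"
  proof (rule exists_column_permutation)
    have "(\<Sum>j<n. fst (?g j)) = (\<Sum>j<n. if j < s + x + y then E_row1 s x j else 0)"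
      by (intro sum.cong) auto
    then show "(\<Sum>j<n. fst (a j, b j)) = (\<Sum>j<n. fst (?g j))"
      using x A by (simp add: sum_E_row[OF sxy])
    have "(\<Sum>j<n. snd (?g j)) = (\<Sum>j<n. if j < s + x + y then E_row2 s x j else 0)"
      by (intro sum.cong) auto
    then show "(\<Sum>j<n. snd (a j, b j)) = (\<Sum>j<n. snd (?g j))"
      using y B by (simp add: sum_E_row[OF sxy])
    have "{j \<in> {..<n}. ?g j = (1,1)} = {..<s}"
      using sxy by (auto simp: E_row1_def E_row2_def split: if_splits)
    then show "card {j \<in> {..<n}. (a j, b j) = (1,1)} = card {j \<in> {..<n}. ?g j = (1,1)}"
      by (simp only: card_lessThan) (simp add: s_def T_def)
  qed (use K in \<open>auto simp: K_def E_row1_def E_row2_def\<close>)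
  then obtain p where p: "p permutes {..<n}" and ab: "\<And>j. j < n \<Longrightarrow> (a j, b j) = ?g (p j)"
    by blast
  let ?a = "\<lambda>j. if j < s + x + y then E_row1 s x j else 0"
  let ?b = "\<lambda>j. if j < s + x + y then E_row2 s x j else 0"
  have "I_int n n a b = I_int n n (\<lambda>j. ?a (p j)) (\<lambda>j. ?b (p j))"
  proof (rule I_int_cong)
    fix j assume "j < n"
    then show "a j = ?a (p j)" "b j = ?b (p j)"
      using ab[of j] by (auto split: if_splits)
  qed
  also have "\<dots> = I_int n n ?a ?b"
    by (rule I_int_permute[OF n p])
  also have "\<dots> = E_int n A B s"
    unfolding E_int_def x_def[symmetric] y_def[symmetric] by (rule I_int_extend[OF sxy, symmetric])
  also have "\<dots> = E_lin n A B (monom 1 s)"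
    using x by (subst E_lin_monom) auto
  also have "monom 1 s = (\<Prod>j<n. wpoly (a j) (b j))"
  proof -
    have "(\<Prod>j<n. wpoly (a j) (b j)) = (\<Prod>j<n. if j \<in> T then monom 1 1 else 1)"
    proof (intro prod.cong refl)
      fix j assume "j \<in> {..<n}"
      then show "wpoly (a j) (b j) = (if j \<in> T then monom 1 1 else 1)"
        using K[of j] by (auto simp: K_def T_def wpoly_simps wpoly_simps[simplified])
    qed
    also have "\<dots> = (\<Prod>j\<in>T. monom 1 1)"
      by (intro prod.mono_neutral_cong_right) (auto simp: T_def)
    also have "\<dots> = monom 1 s"
      by (simp add: s_def monom_power)
    finally show ?thesis ..
  qed
  finally show ?thesis .
qed

text \<open>Both sides obey the same column splitting rule. As long as some column has weight above 2, a
  column is empty by pigeonhole, so that rule applies.\<close>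

lemma I_int_eq_E_lin:
  assumes n: "2 \<le> n" and ev: "\<And>j. j < n \<Longrightarrow> even (a j + b j)"
    and A: "A = (\<Sum>j<n. a j)" and B: "B = (\<Sum>j<n. b j)" and AB: "A + B \<le> 2 * n"
  shows "I_int n n a b = E_lin n A B (\<Prod>j<n. wpoly (a j) (b j))"
  using ev A B
\<comment> \<open>The measure is the total excess over weight 2, with truncated subtraction. A split
  starts from even weight at least 4, lowers that excess by 2, and creates a column of excess
  0.\<close>
proof (induction "\<Sum>j<n. (a j + b j) - 2" arbitrary: a b rule: less_induct)
  case (less a b)
  show ?case
  proof (cases "\<forall>j<n. a j + b j \<le> 2")
    case True
    then show ?thesis
      using less.prems by (intro I_int_small_columns[OF n]) auto
  next
    case False
    then obtain i where i: "i < n" "2 < a i + b i" by auto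
    obtain m where m: "a i + b i = 2 * m"
      using less.prems(1)[OF i(1)] by (elim evenE)
    have "\<exists>j<n. a j + b j = 0"
    proof (rule ccontr)
      assume "\<not> ?thesis"
      then have "2 \<le> a j + b j" if "j < n" for j
        using less.prems(1)[OF that] that by (metis One_nat_def Suc_leI neq0_conv numeral_2_eq_2 odd_one le_antisym not_less_eq_eq)
      then have "(\<Sum>j<n. 2) < (\<Sum>j<n. a j + b j)"
        using i by (intro sum_strict_mono_ex1) auto
      then show False
        using AB less.prems by (simp add: sum.distrib)
    qed
    then obtain j where j: "j < n" "a j = 0" "b j = 0" by auto
    have ij: "i \<noteq> j" using i j by auto
    let ?S = "{..<n} - {i,j}"
    have sum_ij: "(\<Sum>k<n. F k) = F i + F j + (\<Sum>k\<in>?S. F k)" for F :: "nat \<Rightarrow> nat"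
    proof -
      have "(\<Sum>k<n. F k) = (\<Sum>k\<in>insert i (insert j ?S). F k)"
        using i j by (intro sum.cong) auto
      then show ?thesis using ij by simp
    qed
    have prod_ij: "(\<Prod>k<n. F k) = F i * F j * (\<Prod>k\<in>?S. F k)" for F :: "nat \<Rightarrow> real poly"
    proof -
      have "(\<Prod>k<n. F k) = (\<Prod>k\<in>insert i (insert j ?S). F k)"
        using i j by (intro prod.cong) auto
      then show ?thesis using ij by (simp add: mult.assoc)
    qed
    define Q where "Q = (\<Prod>k\<in>?S. wpoly (a k) (b k))"
    \<comment> \<open>One statement for all three splits: (v, v') is (2,0), (1,1) or (0,2), and row
      sums are preserved.\<close>
    have IH: "I_int n n (a(i := u, j := v)) (b(i := u', j := v')) = E_lin n A B (wpoly u u' * wpoly v v' * Q)"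
      if "u + v = a i" "u' + v' = b i" "v + v' = 2" for u v u' v'
    proof -
      let ?a = "a(i := u, j := v)" and ?b = "b(i := u', j := v')"
      have "I_int n n ?a ?b = E_lin n A B (\<Prod>k<n. wpoly (?a k) (?b k))"
      proof (rule less.hyps)
        have "(\<Sum>k\<in>?S. ?a k + ?b k - 2) = (\<Sum>k\<in>?S. a k + b k - 2)"
          by (intro sum.cong) auto
        then show "(\<Sum>k<n. ?a k + ?b k - 2) < (\<Sum>k<n. a k + b k - 2)"
          unfolding sum_ij using that i ij by auto
        have "(\<Sum>k\<in>?S. ?a k) = (\<Sum>k\<in>?S. a k)" "(\<Sum>k\<in>?S. ?b k) = (\<Sum>k\<in>?S. b k)"
          by (intro sum.cong; auto)+
        then show "A = (\<Sum>k<n. ?a k)" "B = (\<Sum>k<n. ?b k)"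
          unfolding less.prems sum_ij using that j ij by auto
        fix k assume "k < n"
        have "u + u' = 2 * (m - 1)"
          using that m i by auto
        then have "even (u + u')" "even (v + v')"
          using that by simp_all
        moreover have "?a k + ?b k \<in> {u + u', v + v', a k + b k}"
          by auto
        ultimately show "even (?a k + ?b k)"
          using less.prems(1)[OF \<open>k < n\<close>] by (metis insertE singletonD)
      qed
      also have "(\<Prod>k<n. wpoly (?a k) (?b k)) = wpoly u u' * wpoly v v' * Q"
      proof -
        have "(\<Prod>k\<in>?S. wpoly (?a k) (?b k)) = Q"
          unfolding Q_def by (intro prod.cong) auto
        then show ?thesis
          unfolding prod_ij using ij by simp
      qed
      finally show ?thesis .
    qed
    have *: "a(i := a i, j := 0) = a" "b(i := b i, j := 0) = b" "a(j := 0) = a" "b(j := 0) = b"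
      using j by auto
    \<comment> \<open>If \<open>a i < 2\<close>, the truncated exponents describe no actual split,
      but the binomial coefficient is 0 and both sides vanish; the other two terms are handled
      likewise.\<close>
    have 1: "real (a i choose 2) * I_int n n (a(i := a i - 2, j := 2)) b
        = real (a i choose 2) * E_lin n A B (wpoly (a i - 2) (b i) * Q)"
    proof (cases "2 \<le> a i")
      case True
      then show ?thesis
        using IH[of "a i - 2" 2 "b i" 0] by (simp add: * wpoly_simps)
    qed simp
    have 2: "real (a i * b i) * I_int n n (a(i := a i - 1, j := 1)) (b(i := b i - 1, j := 1))
        = real (a i * b i) * E_lin n A B (wpoly (a i - 1) (b i - 1) * monom 1 1 * Q)"
    proof (cases "a i = 0 \<or> b i = 0")
      case False
      then show ?thesis
        using IH[of "a i - 1" 1 "b i - 1" 1] by (simp add: wpoly_simps[simplified])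
    qed auto
    have 3: "real (b i choose 2) * I_int n n a (b(i := b i - 2, j := 2))
        = real (b i choose 2) * E_lin n A B (wpoly (a i) (b i - 2) * Q)"
    proof (cases "2 \<le> b i")
      case True
      then show ?thesis
        using IH[of "a i" 0 "b i - 2" 2] by (simp add: * wpoly_simps)
    qed simp
    have "real m * I_int n n a b = E_lin n A B (smult (real m) (wpoly (a i) (b i)) * Q)"
      unfolding I_int_split[OF n i(1) j(1) ij j(2,3) m] wpoly_rec[OF m] 1 2 3
      by (simp add: distrib_right E_lin_add E_lin_smult)
    also have "\<dots> = real m * E_lin n A B (wpoly (a i) (b i) * Q)"
      by (simp add: E_lin_smult)
    finally have "I_int n n a b = E_lin n A B (wpoly (a i) (b i) * Q)"
      using m i by auto
    also have "wpoly (a i) (b i) * Q = (\<Prod>k<n. wpoly (a k) (b k))"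
      unfolding prod_ij Q_def by (simp add: j wpoly_simps)
    finally show ?thesis .
  qed
qed

section \<open>Even columns and the double factorial normalisation\<close>

lemma wpoly_even: "wpoly (2 * a) (2 * b) = (\<Sum>r\<in>{0..min a b}. monom (wcoeff (2 * a) (2 * b) (2 * r)) (2 * r))"
proof (rule poly_eqI)
  fix s
  show "coeff (wpoly (2 * a) (2 * b)) s = coeff (\<Sum>r\<in>{0..min a b}. monom (wcoeff (2 * a) (2 * b) (2 * r)) (2 * r)) s"
  \<comment> \<open>An even number of red points forces an even number of mixed pairs; half of it is
    the summation index of the theorem.\<close>
  proof (cases "even s")
    case True
    then obtain r where r: "s = 2 * r" by (elim evenE)
    show ?thesis
      unfolding r by (simp add: coeff_wpoly coeff_sum) (auto simp: wcoeff_def)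
  next
    case False
    then have "coeff (\<Sum>r\<in>{0..min a b}. monom (wcoeff (2 * a) (2 * b) (2 * r)) (2 * r)) s = 0"
      unfolding coeff_sum by (intro sum.neutral) auto
    moreover have "wcoeff (2 * a) (2 * b) s = 0"
      using False by (auto simp: wcoeff_def)
    ultimately show ?thesis
      by (simp add: coeff_wpoly)
  qed
qed

declare dfact.simps [simp del]

text \<open>In the shifted convention this is the number of pairings of 2a points.\<close>

lemma dfact_even: "real (dfact (2 * a)) = fact (2 * a) / (2 ^ a * fact a)"
proof (induction a)
  case (Suc a)
  have "dfact (2 * Suc a) = (2 * a + 1) * dfact (2 * a)"
    by (subst dfact.simps) simp
  then have "real (dfact (2 * Suc a)) = real (2 * a + 1) * (fact (2 * a) / (2 ^ a * fact a))"
    by (simp only: of_nat_mult Suc)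
  also have "\<dots> = (2 * real (Suc a) * (real (2 * a + 1) * fact (2 * a))) / (2 ^ Suc a * (real (Suc a) * fact a))"
    by (simp add: field_simps del: of_nat_Suc)
  also have "2 * real (Suc a) * (real (2 * a + 1) * fact (2 * a)) = fact (2 * Suc a)"
    by (simp add: algebra_simps)
  also have "real (Suc a) * fact a = fact (Suc a)"
    by simp
  finally show ?case .
qed (simp add: dfact.simps)

text \<open>Origin of the power of 4: the pairing count has 2^(a + b - 2r) in its denominator, the
  two double factorials have 2^(a + b), and the quotient leaves 2^(2r).\<close>

lemma wcoeff_even:
  assumes "r \<le> a" "r \<le> b"
  shows "wcoeff (2 * a) (2 * b) (2 * r) / (real (dfact (2 * a)) * real (dfact (2 * b)))
    = 4 ^ r * fact a * fact b / (fact (2 * r) * fact (a - r) * fact (b - r))"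
proof -
  obtain x y where xy: "a = r + x" "b = r + y"
    using assms by (metis le_iff_add)
  have "F * G / (2 ^ (x + y) * c * d * e) / (F / (2 ^ (r + x) * f) * (G / (2 ^ (r + y) * g)))
      = 4 ^ r * f * g / (c * d * e)" if "F \<noteq> 0" "G \<noteq> 0" for F G c d e f g :: real
  proof -
    have "(4 :: real) ^ r = 2 ^ r * 2 ^ r"
      by (simp flip: power_mult_distrib)
    then show ?thesis
      using that by (simp add: power_add mult_ac)
  qed
  note eq = this
  have "wcoeff (2 * a) (2 * b) (2 * r)
      = fact (2 * a) * fact (2 * b) / (2 ^ (x + y) * fact (2 * r) * fact x * fact y)"
    by (simp add: wcoeff_def xy)
  then show ?thesis
    unfolding dfact_even by (simp only: eq[OF fact_nonzero fact_nonzero] xy add_diff_cancel_left')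
qed

text \<open>The entries 0, 1, 2 have double factorial 1, so the prefactor retains only n and the row
  sums 2A and 2B.\<close>

lemma PhiE_eq:
  assumes "R \<le> A" "R \<le> B"
  shows "PhiE n (2 * R) (A - R) (B - R) =
     real (dfact (2 * A + n - 2) * dfact (2 * B + n - 2)) / real (dfact (n - 2) * dfact (n - 2))
     * E_int n (2 * A) (2 * B) (2 * R)"
proof -
  have d: "dfact 0 = 1" "dfact 1 = 1" "dfact 2 = 1"
    by (simp_all add: dfact.simps)
  have "dfact (E_row1 s x j) = 1" "dfact (E_row2 s x j) = 1" for s x j
    using d by (auto simp: E_row1_def E_row2_def)
  moreover have div: "(2 * A - 2 * R) div 2 = A - R" "(2 * B - 2 * R) div 2 = B - R"
    using assms by auto
  moreover have "(\<Sum>j<2 * R + (A - R) + (B - R). E_row1 (2 * R) (A - R) j) = 2 * A"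
    "(\<Sum>j<2 * R + (A - R) + (B - R). E_row2 (2 * R) (A - R) j) = 2 * B"
    using sum_E_row[of "2 * R" "A - R" "B - R" "2 * R + (A - R) + (B - R)"] assms
    by (simp_all cong: sum.cong_simp)
  ultimately show ?thesis
    unfolding PhiE_def Phi_def E_int_def by (simp)
qed

theorem theorem3p3:
  fixes n q :: nat and a b :: "nat \<Rightarrow> nat"
  defines "A \<equiv> (\<Sum>i<q. a i)" and "B \<equiv> (\<Sum>i<q. b i)"
  assumes "n \<ge> 2" and "n \<ge> A + B" and "q \<le> n"
  shows "Phi n q (\<lambda>i. 2 * a i) (\<lambda>i. 2 * b i) =
    (\<Sum>r \<in> (\<Pi>\<^sub>E i\<in>{..<q}. {0..min (a i) (b i)}).
       (\<Prod>i<q. 4 ^ r i * fact (a i) * fact (b i)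
                 / (fact (2 * r i) * fact (a i - r i) * fact (b i - r i)))
       * PhiE n (2 * (\<Sum>i<q. r i)) (A - (\<Sum>i<q. r i)) (B - (\<Sum>i<q. r i)))"
proof -
  let ?P = "\<Pi>\<^sub>E i\<in>{..<q}. {0..min (a i) (b i)}"
  let ?w = "\<lambda>r i. wcoeff (2 * a i) (2 * b i) (2 * r i)"
  let ?C = "real (dfact (2 * A + n - 2) * dfact (2 * B + n - 2)) / real (dfact (n - 2) * dfact (n - 2))"
  let ?D = "\<Prod>i<q. real (dfact (2 * a i)) * real (dfact (2 * b i))"
  let ?a = "\<lambda>j. if j < q then 2 * a j else 0" and ?b = "\<lambda>j. if j < q then 2 * b j else 0"
  have sums: "(\<Sum>j<n. ?a j) = 2 * A" "(\<Sum>j<n. ?b j) = 2 * B"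
    unfolding A_def B_def sum_distrib_left using \<open>q \<le> n\<close>
    by (auto intro!: sum.mono_neutral_cong_right split: if_splits)
  have R: "(\<Sum>i<q. r i) \<le> A" "(\<Sum>i<q. r i) \<le> B" if "r \<in> ?P" for r
    using that by (auto simp: A_def B_def PiE_iff intro!: sum_mono)
  \<comment> \<open>The doubled matrix has total weight 2A + 2B, so the assumption n \<ge> A + B is
    what \<open>I_int_eq_E_lin\<close> requires.\<close>
  have "I_int n q (\<lambda>i. 2 * a i) (\<lambda>i. 2 * b i) = E_lin n (2 * A) (2 * B) (\<Prod>j<n. wpoly (?a j) (?b j))"
    unfolding I_int_extend[OF \<open>q \<le> n\<close>]
    using assms sums by (intro I_int_eq_E_lin) auto
  also have "(\<Prod>j<n. wpoly (?a j) (?b j)) = (\<Prod>i<q. wpoly (2 * a i) (2 * b i))"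
    using \<open>q \<le> n\<close> by (intro prod.mono_neutral_cong_right) (auto simp: wpoly_simps)
  also have "\<dots> = (\<Sum>r\<in>?P. \<Prod>i<q. monom (?w r i) (2 * r i))"
    unfolding wpoly_even by (intro prod_sum_PiE) auto
  also have "\<dots> = (\<Sum>r\<in>?P. monom (\<Prod>i<q. ?w r i) (2 * (\<Sum>i<q. r i)))"
  proof (intro sum.cong refl)
    fix r :: "nat \<Rightarrow> nat"
    have "(\<Prod>i\<in>S. monom (?w r i) (2 * r i)) = monom (\<Prod>i\<in>S. ?w r i) (2 * (\<Sum>i\<in>S. r i))" if "finite S" for S
      using that by induction (auto simp: mult_monom)
    then show "(\<Prod>i<q. monom (?w r i) (2 * r i)) = monom (\<Prod>i<q. ?w r i) (2 * (\<Sum>i<q. r i))"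
      by blast
  qed
  also have "E_lin n (2 * A) (2 * B) \<dots> = (\<Sum>r\<in>?P. (\<Prod>i<q. ?w r i) * E_int n (2 * A) (2 * B) (2 * (\<Sum>i<q. r i)))"
    unfolding E_lin_sum using R by (intro sum.cong refl E_lin_monom) auto
  finally have I: "I_int n q (\<lambda>i. 2 * a i) (\<lambda>i. 2 * b i)
      = (\<Sum>r\<in>?P. (\<Prod>i<q. ?w r i) * E_int n (2 * A) (2 * B) (2 * (\<Sum>i<q. r i)))" .
  have "Phi n q (\<lambda>i. 2 * a i) (\<lambda>i. 2 * b i) = ?C / ?D * I_int n q (\<lambda>i. 2 * a i) (\<lambda>i. 2 * b i)"
    unfolding Phi_def A_def B_def
    by (simp add: sum_distrib_left prod.distrib mult.assoc)
  \<comment> \<open>The prefactor is distributed: \<open>?D\<close> is divided column by column into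
    the weights, while \<open>?C\<close> turns \<open>E_int\<close> into
    \<open>PhiE\<close>.\<close>
  also have "\<dots> = (\<Sum>r\<in>?P. ((\<Prod>i<q. ?w r i) / ?D) * (?C * E_int n (2 * A) (2 * B) (2 * (\<Sum>i<q. r i))))"
    unfolding I sum_distrib_left by (intro sum.cong refl) (simp add: mult_ac)
  also have "\<dots> = (\<Sum>r \<in> ?P. (\<Prod>i<q. 4 ^ r i * fact (a i) * fact (b i)
                 / (fact (2 * r i) * fact (a i - r i) * fact (b i - r i)))
       * PhiE n (2 * (\<Sum>i<q. r i)) (A - (\<Sum>i<q. r i)) (B - (\<Sum>i<q. r i)))"
  proof (intro sum.cong refl arg_cong2[where f="(*)"])
    fix r assume r: "r \<in> ?P"
    show "(\<Prod>i<q. ?w r i) / ?D = (\<Prod>i<q. 4 ^ r i * fact (a i) * fact (b i)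
                 / (fact (2 * r i) * fact (a i - r i) * fact (b i - r i)))"
      unfolding prod_dividef[symmetric] using r by (intro prod.cong refl wcoeff_even) (auto simp: PiE_iff)
    show "?C * E_int n (2 * A) (2 * B) (2 * (\<Sum>i<q. r i))
        = PhiE n (2 * (\<Sum>i<q. r i)) (A - (\<Sum>i<q. r i)) (B - (\<Sum>i<q. r i))"
      using R[OF r] by (intro PhiE_eq[symmetric])
  qed
  finally show ?thesis .
qed

end
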